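(* Let $N\ge 27$ be an integer. The number of partitions of $N$ into parts congruent to $1$ or $4$ modulo $5$ whose smallest part is at least $11$ is equal to the number of partitions $\lambda\in\mathsf{Diff_2}$ of $N$ such that one of the following holds: (1) $\lambda$ has $m$ parts with $5\le m\le 8$, and $col(\lambda)$ has at most two $2$'s, at most two $3$'s, no $1$'s and no $4$'s; (2) $\lambda$ has $m$ parts with $m\ge 9$, and $col(\lambda)$ has no $1$'s, $4$'s, $6$'s, or $9$'s.
   Context: Partitions are written with weakly decreasing positive parts. $\mathsf{Diff_2}$ is the set of partitions $\lambda=(\lambda_1,\dots,\lambda_m)$ whose consecutive differences are at least two, i.e. $\lambda_i-\lambda_{i+1}\ge 2$ for $1\le i<m$. For $\lambda=(\lambda_1,\dots,\lambda_m)\in\mathsf{Diff_2}$, $col(\lambda)$ is the partition formed by the columns of (i.e. the conjugate of) $(\lambda_1-(2m-1),\lambda_2-(2m-3),\dots,\lambda_m-1)$, where zero entries are ignored. Example: $col((16,12,7,4,1))=(7,5,2,1,0)^T=(4,3,2,2,2,1,1)$. *)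

theory Defs
  imports Main
begin

definition partitions :: "nat \<Rightarrow> nat list set" where
  "partitions n = {\<mu>. sorted_wrt (\<ge>) \<mu> \<and> (\<forall>x\<in>set \<mu>. 0 < x) \<and> sum_list \<mu> = n}"

definition Diff2 :: "nat list set" where
  "Diff2 = {\<mu>. sorted_wrt (\<ge>) \<mu> \<and> (\<forall>x\<in>set \<mu>. 0 < x) \<and>
                (\<forall>i. Suc i < length \<mu> \<longrightarrow> \<mu> ! Suc i + 2 \<le> \<mu> ! i)}"

(* Column lengths of the diagram with row lengths \<mu>. Zero rows contribute nothing. *)
definition conjugate :: "nat list \<Rightarrow> nat list" where
  "conjugate \<mu> = map (\<lambda>j. length (filter (\<lambda>x. j \<le> x) \<mu>)) [1..<Suc (Max (insert 0 (set \<mu>)))]"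

(* With 0-based positions, the staircase entry 2m - 2k + 1 at k = i + 1 is 2(m - i) - 1.
   The subtraction never truncates on Diff2, see Diff2_staircase_le. *)
definition col :: "nat list \<Rightarrow> nat list" where
  "col \<mu> = conjugate (map (\<lambda>i. \<mu> ! i - (2 * (length \<mu> - i) - 1)) [0..<length \<mu>])"

lemma Diff2_staircase_le:
  assumes "\<mu> \<in> Diff2" and "i < length \<mu>"
  shows "2 * (length \<mu> - i) - 1 \<le> \<mu> ! i"
proof -
  have "2 * (length \<mu> - i) - 1 \<le> \<mu> ! i" if "i \<le> length \<mu> - 1" "\<mu> \<noteq> []"
    using that(1)
  proof (induction i rule: inc_induct)
    case base
    have "0 < \<mu> ! (length \<mu> - 1)"
      using assms(1) that(2) by (simp add: Diff2_def)
    then show ?case using that(2) by (simp add: Suc_leI)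
  next
    case (step k)
    have "\<mu> ! Suc k + 2 \<le> \<mu> ! k"
      using assms(1) step.hyps by (simp add: Diff2_def)
    then show ?case using step by linarith
  qed
  then show ?thesis using assms(2) by fastforce
qed

lemma finite_partitions: "finite (partitions n)"
proof -
  have "length \<mu> \<le> sum_list \<mu>" if "\<forall>x\<in>set \<mu>. 0 < x" for \<mu> :: "nat list"
    using that by (induction \<mu>) auto
  then have "partitions n \<subseteq> {\<mu>. set \<mu> \<subseteq> {..n} \<and> length \<mu> \<le> n}"
    by (auto simp: partitions_def member_le_sum_list)
  then show ?thesis
    using finite_lists_length_le[of "{..n}" n] finite_subset by blast
qed

lemma col_example: "col [16, 12, 7, 4, 1] = [4, 3, 2, 2, 2, 1, 1]"
  by (simp add: col_def conjugate_def upt_rec)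

end

theory Submission
  imports Defs "HOL-Computational_Algebra.Formal_Power_Series" "HOL-Library.Multiset"
begin

text \<open>
  Write \<open>(q)\<^sub>m = (1 - q) \<cdots> (1 - q\<^sup>m)\<close> and \<open>F = (1 - q)(1 - q\<^sup>4)(1 - q\<^sup>6)(1 - q\<^sup>9)\<close>.
  Multiplying the first Rogers--Ramanujan identity by \<open>F\<close> deletes the parts 1, 4, 6, 9 on the
  product side and turns the sum side into \<open>\<Sum>\<^sub>m q^(m\<^sup>2) F / (q)\<^sub>m\<close>. Removing the staircase
  \<open>2m-1, \<dots>, 3, 1\<close> shows that \<open>q^(m\<^sup>2) / (q)\<^sub>m\<close> counts the \<open>\<lambda> \<in> Diff2\<close> with \<open>m\<close> parts, the factor
  \<open>1 / (1 - q^k)\<close> recording the multiplicity of \<open>k\<close> in \<open>col \<lambda>\<close>. For \<open>m \<ge> 9\<close> all of \<open>F\<close> cancels.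
  For \<open>5 \<le> m \<le> 8\<close> the factors \<open>1 - q\<close> and \<open>1 - q\<^sup>4\<close> cancel, and
  \<open>(1 - q\<^sup>6) / (1 - q\<^sup>2)\<close> and \<open>(1 - q\<^sup>9) / (1 - q\<^sup>3)\<close> bound the multiplicities of 2 and 3 by two.
  For \<open>m \<le> 4\<close> the term is a polynomial of degree at most 26.

  The Rogers--Ramanujan identity comes from applying Bailey's lemma twice to the unit Bailey pair,
  and its theta series is a product by the finite Jacobi triple product. Limits are replaced by
  congruences modulo powers of \<open>X\<close>.
\<close>

unbundle fps_syntax

section \<open>The Rogers--Ramanujan identity\<close>

definition qpoch :: "'a::comm_ring_1 \<Rightarrow> nat \<Rightarrow> 'a" where
  "qpoch q n = (\<Prod>i=1..n. 1 - q ^ i)"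

text \<open>The Gaussian binomial coefficient, given by a \<open>q\<close>-Pascal rule instead of a
  quotient so that it makes sense in every commutative ring.\<close>

fun qbinom :: "'a::comm_ring_1 \<Rightarrow> nat \<Rightarrow> nat \<Rightarrow> 'a" where
  "qbinom q n 0 = 1"
| "qbinom q 0 (Suc k) = 0"
| "qbinom q (Suc n) (Suc k) = q ^ Suc k * qbinom q n (Suc k) + qbinom q n k"

lemma qpoch_0 [simp]: "qpoch q 0 = 1"
  by (simp add: qpoch_def)

lemma qpoch_Suc: "qpoch q (Suc n) = qpoch q n * (1 - q ^ Suc n)"
  by (simp add: qpoch_def)

lemma qbinom_eq_0: "n < k \<Longrightarrow> qbinom q n k = 0"
  by (induction q n k rule: qbinom.induct) auto

lemma qbinom_self: "qbinom q n n = 1"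
  by (induction n) (auto simp: qbinom_eq_0)

text \<open>The quotient formula with denominators cleared. The induction rests on \<open>q ^ Suc k
  * (1 - q ^ Suc m) + (1 - q ^ Suc k) = 1 - q ^ (k + m + 2)\<close>.\<close>

lemma qbinom_mult_qpoch:
  "k \<le> n \<Longrightarrow> qbinom q n k * qpoch q k * qpoch q (n - k) = qpoch q n"
proof (induction q n k rule: qbinom.induct)
  case (3 q n k)
  show ?case
  proof (cases "k = n")
    case True
    then show ?thesis by (simp add: qbinom_self qbinom_eq_0)
  next
    case False
    then have le: "Suc k \<le> n" using 3 by auto
    then obtain m where m: "n = Suc (k + m)" by (metis add_Suc less_eqE)
    have 1: "qbinom q n (Suc k) * qpoch q (Suc k) * qpoch q m = qpoch q n"
      using 3(1) le m by simp
    have 2: "qbinom q n k * qpoch q k * qpoch q (Suc m) = qpoch q n"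
      using 3(2) le m by simp
    have "qbinom q (Suc n) (Suc k) * qpoch q (Suc k) * qpoch q (Suc m)
        = q ^ Suc k * (1 - q ^ Suc m) * (qbinom q n (Suc k) * qpoch q (Suc k) * qpoch q m)
          + (1 - q ^ Suc k) * (qbinom q n k * qpoch q k * qpoch q (Suc m))"
      by (simp add: qpoch_Suc algebra_simps)
    also have "\<dots> = qpoch q n * (1 - q ^ Suc n)"
      unfolding 1 2 by (simp add: m algebra_simps power_add)
    finally show ?thesis using m by (simp add: qpoch_Suc)
  qed
qed auto

text \<open>Splitting off the factor \<open>y - x\<close> leaves the product for
  \<open>x * q\<close>, hence the induction with \<open>x\<close> arbitrary. The second variable
  \<open>y\<close> makes it possible to avoid negative powers later.\<close>

lemma rothe:
  fixes q x y :: "'a::comm_ring_1"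
  shows "(\<Prod>i<n. y - x * q ^ i) =
    (\<Sum>k\<le>n. (-1) ^ k * q ^ (k choose 2) * qbinom q n k * x ^ k * y ^ (n - k))"
proof (induction n arbitrary: x)
  case (Suc n)
  define T where "T k = (-1) ^ k * q ^ (k choose 2) * qbinom q n k * (x * q) ^ k * y ^ (n - k)" for k
  have ch: "Suc k choose 2 = (k choose 2) + k" for k
    by (simp add: numeral_2_eq_2)
  \<comment> \<open>By the Pascal rule, each new summand collects two neighbouring summands of the
    old sum at \<open>x * q\<close>. The case \<open>k = n\<close> is separate because
    \<open>n - Suc k\<close> truncates there.\<close>
  have split: "(-1) ^ Suc k * q ^ (Suc k choose 2) * qbinom q (Suc n) (Suc k) * x ^ Suc k * y ^ (n - k)
      = y * T (Suc k) - x * T k" if "k \<le> n" for k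
  proof (cases "k = n")
    case True
    then show ?thesis by (simp add: T_def qbinom_eq_0 qbinom_self ch power_add power_mult_distrib)
  next
    case False
    then have "n - k = Suc (n - Suc k)" using that by auto
    then show ?thesis
      by (simp add: T_def ch power_add power_mult_distrib algebra_simps)
  qed
  have "(\<Prod>i<Suc n. y - x * q ^ i) = (y - x) * (\<Prod>i<n. y - (x * q) * q ^ i)"
    by (simp add: prod.lessThan_Suc_shift mult.assoc del: prod.lessThan_Suc)
  also have "\<dots> = (y - x) * (\<Sum>k\<le>n. T k)"
    unfolding T_def Suc.IH by simp
  \<comment> \<open>The first sum may run to \<open>Suc n\<close> because
    \<open>T (Suc n) = 0\<close>.\<close>
  also have "\<dots> = y * (\<Sum>k\<le>Suc n. T k) - x * (\<Sum>k\<le>n. T k)"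
    by (simp add: T_def qbinom_eq_0 algebra_simps)
  also have "(\<Sum>k\<le>Suc n. T k) = T 0 + (\<Sum>k\<le>n. T (Suc k))"
    by (rule sum.atMost_Suc_shift)
  also have "y * (T 0 + (\<Sum>k\<le>n. T (Suc k))) - x * (\<Sum>k\<le>n. T k)
      = y * T 0 + (\<Sum>k\<le>n. y * T (Suc k) - x * T k)"
    by (simp add: sum_subtractf sum_distrib_left algebra_simps)
  also have "y * T 0 = y ^ Suc n"
    by (simp add: T_def numeral_2_eq_2)
  also have "(\<Sum>k\<le>n. y * T (Suc k) - x * T k) = (\<Sum>k\<le>n. (-1) ^ Suc k * q ^ (Suc k choose 2)
      * qbinom q (Suc n) (Suc k) * x ^ Suc k * y ^ (Suc n - Suc k))"
    by (rule sum.cong) (simp_all only: split atMost_iff diff_Suc_Suc)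
  also have "y ^ Suc n + \<dots> = (\<Sum>k\<le>Suc n. (-1) ^ k * q ^ (k choose 2) * qbinom q (Suc n) k * x ^ k * y ^ (Suc n - k))"
    by (subst sum.atMost_Suc_shift) (simp add: numeral_2_eq_2 del: qbinom.simps(3) power_Suc)
  finally show ?case .
qed (simp add: numeral_2_eq_2)

section \<open>The finite Jacobi triple product\<close>

lemma choose_two_add: "(m + n) choose 2 = (m choose 2) + (n choose 2) + m * n"
  by (induction n) (auto simp: numeral_2_eq_2)

lemma square_eq_choose_two: "n * n = 2 * (n choose 2) + n"
  by (induction n) (auto simp: numeral_2_eq_2)

text \<open>Pairing the indices at equal distance from the centre turns Rothe's sum into the folded
  form used by \<open>theta_term\<close>.\<close>

lemma sum_fold_center:
  fixes f :: "nat \<Rightarrow> 'a::comm_monoid_add"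
  shows "(\<Sum>k\<le>2 * N. f k) = f N + (\<Sum>r=1..N. f (N + r) + f (N - r))"
proof -
  have "(\<Sum>k\<le>2 * N. f k) = sum f ({..<N} \<union> {N} \<union> {N<..2 * N})"
    by (rule sum.cong) auto
  also have "\<dots> = sum f {..<N} + f N + sum f {N<..2 * N}"
    by (subst sum.union_disjoint; (subst sum.union_disjoint)?) auto
  also have "sum f {..<N} = (\<Sum>r=1..N. f (N - r))"
    by (rule sum.reindex_bij_witness[of _ "\<lambda>r. N - r" "\<lambda>k. N - k"]) auto
  also have "sum f {N<..2 * N} = (\<Sum>r=1..N. f (N + r))"
    by (rule sum.reindex_bij_witness[of _ "\<lambda>r. N + r" "\<lambda>k. k - N"]) auto
  finally show ?thesis by (simp add: sum.distrib add_ac)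
qed

text \<open>The terms of index \<open>r\<close> and \<open>-r\<close> of a two-sided theta series, added up; this keeps all exponents natural.\<close>

definition theta_term :: "nat \<Rightarrow> nat \<Rightarrow> nat \<Rightarrow> 'a::comm_ring_1 \<Rightarrow> 'a" where
  "theta_term b b' r p = (if r = 0 then 1 else
     (-1) ^ r * p ^ ((b + b') * (r choose 2)) * (p ^ (b * r) + p ^ (b' * r)))"

lemma qpoch_power_nth_0 [simp]: "d > 0 \<Longrightarrow> qpoch (fps_X ^ d :: 'a::field fps) n $ 0 = 1"
  by (induction n) (auto simp: qpoch_Suc power_mult[symmetric] fps_mult_nth_0 zero_power)

lemma qpoch_power_nz [simp]: "d > 0 \<Longrightarrow> qpoch (fps_X ^ d :: 'a::field fps) n \<noteq> 0"
  by (metis fps_zero_nth qpoch_power_nth_0 zero_neq_one)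

text \<open>The recursion hides the symmetry. Both sides give \<open>qpoch ?q (2 * N)\<close> after
  multiplication by the same nonzero series, which can be cancelled in an integral domain.\<close>

lemma qbinom_sym:
  assumes "d > 0" "r \<le> N"
  shows "qbinom (fps_X ^ d :: 'a::field fps) (2 * N) (N - r) = qbinom (fps_X ^ d) (2 * N) (N + r)"
proof -
  let ?q = "fps_X ^ d :: 'a fps"
  have "qbinom ?q (2 * N) (N - r) * (qpoch ?q (N - r) * qpoch ?q (N + r)) = qpoch ?q (2 * N)"
    using qbinom_mult_qpoch[of "N - r" "2 * N" ?q] assms by (simp add: mult.assoc mult_2)
  moreover have "qbinom ?q (2 * N) (N + r) * (qpoch ?q (N - r) * qpoch ?q (N + r)) = qpoch ?q (2 * N)"
    using qbinom_mult_qpoch[of "N + r" "2 * N" ?q] assms by (simp add: mult_ac mult_2)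
  ultimately show ?thesis using assms
    by (metis mult_right_cancel no_zero_divisors qpoch_power_nz)
qed

text \<open>Rothe's identity at \<open>x = p^b\<close>, \<open>y = Q^N\<close> with \<open>2N\<close> factors, after cancelling a common power of \<open>p\<close>.\<close>

lemma finite_jacobi_triple:
  fixes p Q :: "'a::field fps" and b b' :: nat
  defines "p \<equiv> fps_X"
  defines "Q \<equiv> p ^ (b + b')"
  assumes "b + b' > 0"
  shows "(\<Prod>i<N. 1 - p ^ b * Q ^ i) * (\<Prod>i<N. 1 - p ^ b' * Q ^ i) =
    (\<Sum>r\<le>N. theta_term b b' r p * qbinom Q (2 * N) (N + r))"
proof -
  \<comment> \<open>\<open>c\<close> is the summand \<open>f N\<close> below without its Gaussian
    binomial. Both sides turn out to be multiples of it.\<close>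
  define c where "c = (-1) ^ N * (p ^ b) ^ N * Q ^ (N choose 2) * Q ^ (N * N)"
  have cnz: "c \<noteq> 0" by (simp add: c_def Q_def p_def)
  define f where "f k = (-1) ^ k * Q ^ (k choose 2) * qbinom Q (2 * N) k * (p ^ b) ^ k * (Q ^ N) ^ (2 * N - k)" for k
  have "(\<Prod>i<2 * N. Q ^ N - p ^ b * Q ^ i) =
      (\<Prod>i<N. Q ^ N - p ^ b * Q ^ i) * (\<Prod>i<N. Q ^ N - p ^ b * Q ^ (N + i))"
    unfolding mult_2 lessThan_atLeast0
    by (subst prod.atLeastLessThan_concat[of 0 N "N + N", symmetric])
       (auto intro!: arg_cong2[of _ _ _ _ "(*)"] prod.reindex_bij_witness[of _ "\<lambda>i. i + N" "\<lambda>i. i - N"])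
  also have "(\<Prod>i<N. Q ^ N - p ^ b * Q ^ (N + i)) = Q ^ (N * N) * (\<Prod>i<N. 1 - p ^ b * Q ^ i)"
  proof -
    have "Q ^ N - p ^ b * Q ^ (N + i) = Q ^ N * (1 - p ^ b * Q ^ i)" for i
      by (simp add: power_add algebra_simps)
    then show ?thesis by (simp add: prod.distrib power_mult)
  qed
  also have "(\<Prod>i<N. Q ^ N - p ^ b * Q ^ i) =
     (-1) ^ N * (p ^ b) ^ N * Q ^ (N choose 2) * (\<Prod>i<N. 1 - p ^ b' * Q ^ i)"
  proof -
    \<comment> \<open>Taking out the lower power of \<open>p\<close> uses
      \<open>Q = p ^ b * p ^ b'\<close>. This is where \<open>b'\<close> enters, with the factors in
      reverse order.\<close>
    have "Q ^ N - p ^ b * Q ^ i = (-1) * p ^ b * Q ^ i * (1 - p ^ b' * Q ^ (N - Suc i))" if "i < N" for i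
    proof -
      have "N = Suc (i + (N - Suc i))" using that by simp
      then have "Q ^ N = p ^ b * p ^ b' * Q ^ i * Q ^ (N - Suc i)"
        by (metis Q_def power_Suc power_add mult.assoc)
      then show ?thesis by (simp add: algebra_simps)
    qed
    then have "(\<Prod>i<N. Q ^ N - p ^ b * Q ^ i) =
        (\<Prod>i<N. (-1) * p ^ b * Q ^ i * (1 - p ^ b' * Q ^ (N - Suc i)))" by simp
    also have "\<dots> = (-1) ^ N * (p ^ b) ^ N * Q ^ (\<Sum>i<N. i) * (\<Prod>i<N. 1 - p ^ b' * Q ^ (N - Suc i))"
      by (simp add: prod.distrib power_mult power_sum prod_uminus)
    also have "(\<Prod>i<N. 1 - p ^ b' * Q ^ (N - Suc i)) = (\<Prod>i<N. 1 - p ^ b' * Q ^ i)"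
      by (rule prod.nat_diff_reindex)
    also have "(\<Sum>i<N. i) = N choose 2"
      by (induction N) (auto simp: numeral_2_eq_2)
    finally show ?thesis .
  qed
  finally have prod: "(\<Prod>i<2 * N. Q ^ N - p ^ b * Q ^ i) =
     c * ((\<Prod>i<N. 1 - p ^ b * Q ^ i) * (\<Prod>i<N. 1 - p ^ b' * Q ^ i))"
    by (simp add: c_def mult_ac)
  have plus: "f (N + r) = c * ((-1) ^ r * p ^ ((b + b') * (r choose 2)) * p ^ (b * r) * qbinom Q (2 * N) (N + r))"
    if "r \<le> N" for r
  proof -
    have e: "(N + r choose 2) + N * (N - r) = (N choose 2) + N * N + (r choose 2)"
      using that by (simp add: choose_two_add diff_mult_distrib2)
    have "Q ^ (N + r choose 2) * (Q ^ N) ^ (2 * N - (N + r)) = Q ^ ((N + r choose 2) + N * (N - r))"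
      using that by (simp add: power_add power_mult mult_2)
    also have "\<dots> = Q ^ (N choose 2) * Q ^ (N * N) * p ^ ((b + b') * (r choose 2))"
      unfolding e by (simp add: power_add Q_def power_mult)
    finally have "Q ^ (N + r choose 2) * (Q ^ N) ^ (2 * N - (N + r))
      = Q ^ (N choose 2) * Q ^ (N * N) * p ^ ((b + b') * (r choose 2))" .
    moreover have "f (N + r) = (-1) ^ (N + r) * qbinom Q (2 * N) (N + r) * (p ^ b) ^ (N + r) *
       (Q ^ (N + r choose 2) * (Q ^ N) ^ (2 * N - (N + r)))"
      by (simp only: f_def mult_ac)
    ultimately show ?thesis by (simp add: c_def power_add power_mult mult_ac)
  qed
  have minus: "f (N - r) = c * ((-1) ^ r * p ^ ((b + b') * (r choose 2)) * p ^ (b' * r) * qbinom Q (2 * N) (N + r))"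
    if "r \<le> N" for r
  proof -
    \<comment> \<open>\<open>N = M + r\<close> replaces truncated subtraction by addition.\<close>
    obtain M where M: "N = M + r" using \<open>r \<le> N\<close> by (metis add.commute le_Suc_ex)
    have sgn: "(-1) ^ (N - r) = (-1 :: 'a fps) ^ N * (-1) ^ r"
      by (simp add: M power_add mult.assoc flip: power_mult_distrib)
    have e: "(N - r choose 2) + N * (N + r) = (N choose 2) + N * N + (r choose 2) + r"
      using square_eq_choose_two[of r] by (simp add: M choose_two_add algebra_simps)
    have "Q ^ (N - r choose 2) * (Q ^ N) ^ (2 * N - (N - r)) = Q ^ ((N - r choose 2) + N * (N + r))"
      using that by (simp add: power_add power_mult mult_2)
    also have "\<dots> = Q ^ (N choose 2) * Q ^ (N * N) * p ^ ((b + b') * (r choose 2)) * Q ^ r"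
      unfolding e by (simp add: power_add Q_def power_mult)
    finally have 1: "Q ^ (N - r choose 2) * (Q ^ N) ^ (2 * N - (N - r))
      = Q ^ (N choose 2) * Q ^ (N * N) * p ^ ((b + b') * (r choose 2)) * Q ^ r" .
    \<comment> \<open>The surplus \<open>Q ^ r\<close> makes up for the missing
      \<open>p ^ (b * r)\<close> and leaves \<open>p ^ (b' * r)\<close>.\<close>
    have 2: "(p ^ b) ^ (N - r) * Q ^ r = (p ^ b) ^ N * p ^ (b' * r)"
      by (simp add: M Q_def algebra_simps flip: power_add power_mult)
    have "f (N - r) = (-1) ^ (N - r) * qbinom Q (2 * N) (N - r) * (p ^ b) ^ (N - r) *
       (Q ^ (N - r choose 2) * (Q ^ N) ^ (2 * N - (N - r)))"
      by (simp only: f_def mult_ac)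
    also have "\<dots> = (-1) ^ (N - r) * qbinom Q (2 * N) (N - r) * ((p ^ b) ^ (N - r) * Q ^ r) *
       (Q ^ (N choose 2) * Q ^ (N * N) * p ^ ((b + b') * (r choose 2)))"
      unfolding 1 by (simp only: mult_ac)
    also have "\<dots> = c * ((-1) ^ r * p ^ ((b + b') * (r choose 2)) * p ^ (b' * r) * qbinom Q (2 * N) (N - r))"
      unfolding 2 sgn c_def by (simp only: mult_ac)
    also have "qbinom Q (2 * N) (N - r) = qbinom Q (2 * N) (N + r)"
      unfolding Q_def p_def using assms(3) \<open>r \<le> N\<close> by (rule qbinom_sym)
    finally show ?thesis .
  qed
  have "c * ((\<Prod>i<N. 1 - p ^ b * Q ^ i) * (\<Prod>i<N. 1 - p ^ b' * Q ^ i)) = (\<Sum>k\<le>2 * N. f k)"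
    unfolding prod[symmetric] by (simp only: rothe f_def)
  also have "\<dots> = f N + (\<Sum>r=1..N. f (N + r) + f (N - r))"
    by (rule sum_fold_center)
  also have "f N = c * (theta_term b b' 0 p * qbinom Q (2 * N) N)"
    using plus[of 0] by (simp add: theta_term_def binomial_eq_0)
  also have "(\<Sum>r=1..N. f (N + r) + f (N - r)) = (\<Sum>r=1..N. c * (theta_term b b' r p * qbinom Q (2 * N) (N + r)))"
    by (rule sum.cong) (auto simp add: plus minus theta_term_def distrib_left distrib_right mult.assoc)
  also have "c * (theta_term b b' 0 p * qbinom Q (2 * N) N) + \<dots>
     = c * (\<Sum>r\<le>N. theta_term b b' r p * qbinom Q (2 * N) (N + r))"
    by (simp add: atMost_atLeast0 sum.atLeast_Suc_atMost[of 0 N] sum_distrib_left[symmetric] distrib_left)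
  finally show ?thesis using cnz by simp
qed

section \<open>Bailey's lemma and the finite form of the identity\<close>

definition inv_qpoch :: "nat \<Rightarrow> 'a::field fps" where
  "inv_qpoch n = inverse (qpoch fps_X n)"

lemma qpoch_X_nth_0 [simp]: "qpoch (fps_X :: 'a::field fps) n $ 0 = 1"
  using qpoch_power_nth_0[of 1] by simp

lemma inv_qpoch_0 [simp]: "inv_qpoch 0 = 1"
  by (simp add: inv_qpoch_def)

lemma qpoch_mult_inv [simp]: "qpoch fps_X n * inv_qpoch n = (1 :: 'a::field fps)"
  by (simp add: inv_qpoch_def inverse_mult_eq_1')

lemma inv_qpoch_Suc: "(1 - fps_X ^ Suc n) * inv_qpoch (Suc n) = (inv_qpoch n :: 'a::field fps)"
proof -
  have "qpoch fps_X n * ((1 - fps_X ^ Suc n) * inv_qpoch (Suc n)) = qpoch fps_X n * (inv_qpoch n :: 'a fps)"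
    using qpoch_mult_inv[of "Suc n", where 'a = 'a] by (simp add: qpoch_Suc mult.assoc del: power_Suc)
  moreover have "qpoch fps_X n \<noteq> (0 :: 'a fps)"
    using qpoch_power_nz[of 1 n, where 'a = 'a] by simp
  ultimately show ?thesis by (metis mult_left_cancel)
qed

lemma qbinom_X_conv_inv:
  assumes "k \<le> n"
  shows "qbinom fps_X n k = qpoch fps_X n * inv_qpoch k * (inv_qpoch (n - k) :: 'a::field fps)"
proof -
  have "qbinom fps_X n k * qpoch fps_X k * qpoch fps_X (n - k) = (qpoch fps_X n :: 'a fps)"
    using assms by (rule qbinom_mult_qpoch)
  then have "qpoch fps_X n * inv_qpoch k * inv_qpoch (n - k) =
     qbinom fps_X n k * (qpoch fps_X k * inv_qpoch k) * (qpoch fps_X (n - k) * inv_qpoch (n - k) :: 'a fps)"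
    by (simp only: mult_ac)
  then show ?thesis by simp
qed

text \<open>A limiting case of the \<open>q\<close>-Vandermonde sum. With
  \<open>inv_qpoch (t + a)\<close> rewritten through \<open>inv_qpoch (t + Suc a)\<close>, the
  Pascal rule splits the sum for \<open>Suc M\<close> into pieces \<open>T t - U t\<close> and
  \<open>U t\<close>. The \<open>U\<close> cancel, and the sum for \<open>M\<close> and
  \<open>Suc a\<close> remains.\<close>

lemma bailey_kernel_qbinom:
  "(\<Sum>t\<le>M. fps_X ^ (t * (t + a)) * qbinom fps_X M t * inv_qpoch (t + a)) = (inv_qpoch (M + a) :: 'a::field fps)"
proof (induction M arbitrary: a)
  case (Suc M)
  define T where "T t = fps_X ^ (t * (t + Suc a)) * qbinom fps_X M t * (inv_qpoch (t + Suc a) :: 'a fps)" for t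
  define U where "U t = fps_X ^ (t + Suc a) * T t" for t
  have 1: "fps_X ^ (t * (t + a)) * fps_X ^ t * qbinom fps_X M t * inv_qpoch (t + a) = T t - U t" for t
  proof -
    have "fps_X ^ (t * (t + a)) * fps_X ^ t = (fps_X ^ (t * (t + Suc a)) :: 'a fps)"
      by (simp flip: power_add)
    moreover have "inv_qpoch (t + a) = (1 - fps_X ^ (t + Suc a)) * (inv_qpoch (t + Suc a) :: 'a fps)"
      by (simp add: inv_qpoch_Suc del: power_Suc)
    moreover have "A * q * ((1 - Y) * I) = A * q * I - Y * (A * q * I)" for A q Y I :: "'a fps"
      by (simp add: algebra_simps)
    ultimately show ?thesis by (simp only: T_def U_def)
  qed
  have 2: "fps_X ^ (Suc t * (Suc t + a)) * qbinom fps_X M t * inv_qpoch (Suc t + a) = U t" for t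
  proof -
    have "Suc t * (Suc t + a) = (t + Suc a) + t * (t + Suc a)" by simp
    then have "fps_X ^ (Suc t * (Suc t + a)) = fps_X ^ (t + Suc a) * (fps_X ^ (t * (t + Suc a)) :: 'a fps)"
      by (simp only: power_add)
    then show ?thesis by (simp add: U_def T_def mult.assoc del: power_Suc)
  qed
  have "(\<Sum>t\<le>Suc M. fps_X ^ (t * (t + a)) * qbinom fps_X (Suc M) t * (inv_qpoch (t + a) :: 'a fps)) =
     inv_qpoch a + (\<Sum>t\<le>M. fps_X ^ (Suc t * (Suc t + a)) * fps_X ^ Suc t * qbinom fps_X M (Suc t) * inv_qpoch (Suc t + a)
       + fps_X ^ (Suc t * (Suc t + a)) * qbinom fps_X M t * inv_qpoch (Suc t + a))"
    by (subst sum.atMost_Suc_shift) (simp add: algebra_simps)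
  also have "\<dots> = inv_qpoch a + (\<Sum>t\<le>M. (T (Suc t) - U (Suc t)) + U t)"
    by (simp only: 1 2)
  also have "inv_qpoch a = T 0 - U 0"
    using 1[of 0] by simp
  also have "T 0 - U 0 + (\<Sum>t\<le>M. (T (Suc t) - U (Suc t)) + U t) = (\<Sum>t\<le>Suc M. T t - U t) + (\<Sum>t\<le>M. U t)"
    by (subst sum.atMost_Suc_shift) (simp only: sum.distrib add.assoc)
  also have "\<dots> = (\<Sum>t\<le>M. T t)"
    by (simp add: sum_subtractf T_def U_def qbinom_eq_0)
  also have "\<dots> = inv_qpoch (Suc M + a)"
    unfolding T_def by (subst Suc.IH) simp
  finally show ?case .
qed simp

text \<open>The previous sum divided by \<open>qpoch fps_X M\<close>, which is the shape of the
  inner sum in Bailey's lemma.\<close>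

lemma bailey_kernel:
  "(\<Sum>t\<le>M. fps_X ^ (t * (t + a)) * inv_qpoch (M - t) * inv_qpoch t * inv_qpoch (t + a)) =
   inv_qpoch M * (inv_qpoch (M + a) :: 'a::field fps)"
proof -
  have *: "inv_qpoch M * (qbinom fps_X M t * f) = inv_qpoch t * (inv_qpoch (M - t) * f)" if "t \<le> M" for t and f :: "'a fps"
  proof -
    have "inv_qpoch M * (qbinom fps_X M t * f) =
       (qpoch fps_X M * inv_qpoch M) * (inv_qpoch t * (inv_qpoch (M - t) * f))"
      unfolding qbinom_X_conv_inv[OF that] by (simp only: mult_ac)
    then show ?thesis by simp
  qed
  have "inv_qpoch M * (inv_qpoch (M + a) :: 'a fps) =
     (\<Sum>t\<le>M. fps_X ^ (t * (t + a)) * (inv_qpoch M * (qbinom fps_X M t * inv_qpoch (t + a))))"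
    by (subst bailey_kernel_qbinom[symmetric]) (simp add: sum_distrib_left mult_ac)
  also have "\<dots> = (\<Sum>t\<le>M. fps_X ^ (t * (t + a)) * inv_qpoch (M - t) * inv_qpoch t * inv_qpoch (t + a))"
    by (rule sum.cong) (simp_all add: * mult_ac)
  finally show ?thesis by simp
qed

text \<open>Bailey pairs relative to 1, with \<open>\<alpha> r\<close> standing for the sum of the usual \<open>\<alpha>\<close> at \<open>r\<close> and \<open>-r\<close>.\<close>

definition bailey_pair :: "(nat \<Rightarrow> 'a::field fps) \<Rightarrow> (nat \<Rightarrow> 'a fps) \<Rightarrow> bool" where
  "bailey_pair \<alpha> \<beta> \<longleftrightarrow> (\<forall>N. \<beta> N = (\<Sum>r\<le>N. \<alpha> r * inv_qpoch (N - r) * inv_qpoch (N + r)))"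

text \<open>The case of Bailey's lemma with both free parameters sent to infinity. After
  interchanging the summations, the inner sum is \<open>bailey_kernel\<close> with
  \<open>M = N - r\<close> and \<open>a = 2 * r\<close>.\<close>

lemma bailey_lemma:
  fixes \<alpha> \<beta> :: "nat \<Rightarrow> 'a::field fps"
  assumes "bailey_pair \<alpha> \<beta>"
  shows "bailey_pair (\<lambda>r. fps_X ^ (r * r) * \<alpha> r) (\<lambda>N. \<Sum>s\<le>N. fps_X ^ (s * s) * inv_qpoch (N - s) * \<beta> s)"
  unfolding bailey_pair_def
proof
  fix N
  define g :: "nat \<Rightarrow> nat \<Rightarrow> 'a fps" where
    "g s r = fps_X ^ (s * s) * inv_qpoch (N - s) * (\<alpha> r * inv_qpoch (s - r) * inv_qpoch (s + r))" for s r
  have "(\<Sum>s\<le>N. fps_X ^ (s * s) * inv_qpoch (N - s) * \<beta> s) = (\<Sum>s\<le>N. \<Sum>r\<le>s. g s r)"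
    using assms by (simp add: bailey_pair_def g_def sum_distrib_left)
  also have "\<dots> = (\<Sum>(s, r)\<in>(SIGMA s:{..N}. {..s}). g s r)"
    by (rule sum.Sigma) auto
  \<comment> \<open>The triangle \<open>r \<le> s \<le> N\<close> is parametrised by
    \<open>s = t + r\<close>.\<close>
  also have "\<dots> = (\<Sum>(r, t)\<in>(SIGMA r:{..N}. {..N - r}). g (t + r) r)"
    by (rule sum.reindex_bij_witness[of _ "\<lambda>(r, t). (t + r, r)" "\<lambda>(s, r). (r, s - r)"]) auto
  also have "\<dots> = (\<Sum>r\<le>N. \<Sum>t\<le>N - r. g (t + r) r)"
    by (rule sum.Sigma[symmetric]) auto
  also have "\<dots> = (\<Sum>r\<le>N. fps_X ^ (r * r) * \<alpha> r * inv_qpoch (N - r) * inv_qpoch (N + r))"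
  proof (rule sum.cong, rule refl)
    fix r assume "r \<in> {..N}"
    then have e: "N - r + 2 * r = N + r" by simp
    have "g (t + r) r = fps_X ^ (r * r) * \<alpha> r *
       (fps_X ^ (t * (t + 2 * r)) * inv_qpoch (N - r - t) * inv_qpoch t * inv_qpoch (t + 2 * r))" for t
    proof -
      have "(t + r) * (t + r) = r * r + t * (t + 2 * r)"
        by (simp add: algebra_simps)
      then have "fps_X ^ ((t + r) * (t + r)) = fps_X ^ (r * r) * (fps_X ^ (t * (t + 2 * r)) :: 'a fps)"
        by (simp only: power_add)
      moreover have "N - (t + r) = N - r - t" "t + r + r = t + 2 * r" by simp_all
      ultimately show ?thesis by (simp only: g_def mult_ac add_diff_cancel_right')
    qed
    then have "(\<Sum>t\<le>N - r. g (t + r) r) = fps_X ^ (r * r) * \<alpha> r * (inv_qpoch (N - r) * inv_qpoch (N - r + 2 * r))"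
      by (simp only: sum_distrib_left[symmetric] bailey_kernel)
    then show "(\<Sum>t\<le>N - r. g (t + r) r) = fps_X ^ (r * r) * \<alpha> r * inv_qpoch (N - r) * inv_qpoch (N + r)"
      unfolding e by (simp add: mult_ac)
  qed
  finally show "(\<Sum>s\<le>N. fps_X ^ (s * s) * inv_qpoch (N - s) * \<beta> s) =
    (\<Sum>r\<le>N. fps_X ^ (r * r) * \<alpha> r * inv_qpoch (N - r) * inv_qpoch (N + r))" .
qed

text \<open>For \<open>b = 0\<close> the product side of the triple product contains the factor \<open>1 - 1\<close>.\<close>

lemma unit_bailey_pair:
  "bailey_pair (\<lambda>r. theta_term 0 1 r (fps_X :: 'a::field fps)) (\<lambda>N. if N = 0 then 1 else 0)"
  unfolding bailey_pair_def
proof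
  fix N
  let ?S = "\<Sum>r\<le>N. theta_term 0 1 r fps_X * inv_qpoch (N - r) * (inv_qpoch (N + r) :: 'a fps)"
  have "(\<Sum>r\<le>N. theta_term 0 1 r fps_X * qbinom fps_X (2 * N) (N + r)) = qpoch fps_X (2 * N) * ?S"
    unfolding sum_distrib_left
    by (rule sum.cong) (auto simp: qbinom_X_conv_inv mult_ac mult_2)
  then have "(\<Prod>i<N. 1 - fps_X ^ i) * (\<Prod>i<N. 1 - fps_X * fps_X ^ i) = qpoch fps_X (2 * N) * ?S"
    using finite_jacobi_triple[of 0 1 N, where 'a = 'a] by simp
  moreover have "(\<Prod>i<N. 1 - fps_X ^ i :: 'a fps) = 0" if "N > 0"
    by (rule prod_zero) (use that in \<open>auto intro!: bexI[of _ 0]\<close>)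
  moreover have "qpoch (fps_X :: 'a fps) (2 * N) \<noteq> 0"
    using qpoch_power_nz[of 1, where 'a = 'a] by simp
  ultimately have "?S = 0" if "N > 0" using that by auto
  then show "(if N = 0 then 1 else 0) = ?S"
    by (auto simp: theta_term_def)
qed

text \<open>The first application of Bailey's lemma gives \<open>inv_qpoch\<close>, the second the
  left-hand side. The two factors \<open>fps_X ^ (r * r)\<close> add
  \<open>4 * (r choose 2) + 2 * r\<close> to the exponents, which moves the theta parameters from 0,
  1 to 2, 3.\<close>

lemma bressoud_identity:
  "(\<Sum>s\<le>N. fps_X ^ (s * s) * inv_qpoch (N - s) * inv_qpoch s) =
   (\<Sum>r\<le>N. theta_term 2 3 r (fps_X :: 'a::field fps) * inv_qpoch (N - r) * inv_qpoch (N + r))"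
proof -
  have \<beta>: "(\<Sum>s\<le>M. fps_X ^ (s * s) * inv_qpoch (M - s) * (if s = 0 then 1 else 0)) = (inv_qpoch M :: 'a fps)" for M
    by (simp add: sum.atMost_shift)
  have \<alpha>: "fps_X ^ (r * r) * (fps_X ^ (r * r) * theta_term 0 1 r fps_X) = theta_term 2 3 r (fps_X :: 'a fps)" for r
    using square_eq_choose_two[of r]
    by (simp add: theta_term_def binomial_eq_0 algebra_simps flip: power_add)
  show ?thesis
    using bailey_lemma[OF bailey_lemma[OF unit_bailey_pair, where 'a = 'a]]
    unfolding \<beta> \<alpha> bailey_pair_def by blast
qed

section \<open>Congruences modulo powers of \<open>X\<close> in place of limits\<close>

definition fps_cong :: "nat \<Rightarrow> 'a::field fps \<Rightarrow> 'a fps \<Rightarrow> bool" where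
  "fps_cong n f g \<longleftrightarrow> (\<forall>i<n. f $ i = g $ i)"

lemma fps_cong_refl [simp]: "fps_cong n f f"
  and fps_cong_sym: "fps_cong n f g \<Longrightarrow> fps_cong n g f"
  and fps_cong_trans [trans]: "fps_cong n f g \<Longrightarrow> fps_cong n g h \<Longrightarrow> fps_cong n f h"
  by (simp_all add: fps_cong_def)

lemma fps_cong_add: "fps_cong n f f' \<Longrightarrow> fps_cong n g g' \<Longrightarrow> fps_cong n (f + g) (f' + g')"
  by (simp add: fps_cong_def)

lemma fps_cong_diff: "fps_cong n f f' \<Longrightarrow> fps_cong n g g' \<Longrightarrow> fps_cong n (f - g) (f' - g')"
  by (simp add: fps_cong_def)

lemma fps_cong_mult: "fps_cong n f f' \<Longrightarrow> fps_cong n g g' \<Longrightarrow> fps_cong n (f * g) (f' * g')"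
  by (auto simp: fps_cong_def fps_mult_nth intro!: sum.cong)

lemma fps_cong_sum: "(\<And>x. x \<in> A \<Longrightarrow> fps_cong n (f x) (g x)) \<Longrightarrow> fps_cong n (sum f A) (sum g A)"
  by (simp add: fps_cong_def fps_sum_nth)

lemma fps_cong_X_power: "n \<le> k \<Longrightarrow> fps_cong n (fps_X ^ k * f) 0"
  by (simp add: fps_cong_def fps_X_power_mult_nth)

lemma fps_cong_sum_truncate:
  fixes f g :: "nat \<Rightarrow> 'a::field fps"
  assumes "n \<le> N"
    and "\<And>r. r \<le> n \<Longrightarrow> fps_cong m (f r) (g r)"
    and "\<And>r. n < r \<Longrightarrow> r \<le> N \<Longrightarrow> fps_cong m (f r) 0"
  shows "fps_cong m (\<Sum>r\<le>N. f r) (\<Sum>r\<le>n. g r)"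
proof -
  have "(\<Sum>r\<le>N. f r) = (\<Sum>r\<le>n. f r) + (\<Sum>r\<in>{n<..N}. f r)"
    using assms(1) by (subst sum.union_disjoint[symmetric]) (auto intro!: sum.cong)
  also have "fps_cong m \<dots> ((\<Sum>r\<le>n. g r) + (\<Sum>r\<in>{n<..N}. 0))"
    using assms(2,3) by (intro fps_cong_add fps_cong_sum) auto
  finally show ?thesis by simp
qed

text \<open>Every factor of index above \<open>n\<close> is 1 modulo \<open>X ^ n\<close>, since
  \<open>d > 0\<close>.\<close>

lemma qpoch_cong:
  assumes "d > 0" "n \<le> M"
  shows "fps_cong n (qpoch (fps_X ^ d) M) (qpoch (fps_X ^ d :: 'a::field fps) n)"
  using assms(2)
proof (induction M rule: dec_induct)
  case (step M)
  have "n \<le> d * Suc M" using step assms(1) by (metis le_SucI le_trans mult_le_mono1 nat_mult_1 less_eq_Suc_le One_nat_def)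
  then have "fps_cong n (fps_X ^ (d * Suc M) * qpoch (fps_X ^ d) M) (0 :: 'a fps)"
    by (rule fps_cong_X_power)
  moreover have "qpoch (fps_X ^ d) (Suc M) =
      qpoch (fps_X ^ d) M - fps_X ^ (d * Suc M) * qpoch (fps_X ^ d) M"
    by (simp only: qpoch_Suc power_mult) (simp add: algebra_simps)
  ultimately show ?case using fps_cong_diff[OF step.IH] by (metis diff_zero)
qed simp

lemma inv_qpoch_cong:
  assumes "n \<le> M"
  shows "fps_cong n (inv_qpoch M) (inv_qpoch n :: 'a::field fps)"
proof -
  have "inv_qpoch M = inv_qpoch M * (qpoch fps_X n * (inv_qpoch n :: 'a fps))" by simp
  also have "fps_cong n \<dots> (inv_qpoch M * (qpoch fps_X M * inv_qpoch n))"
    using fps_cong_sym[OF qpoch_cong[of 1 n M, where 'a = 'a]] assms by (intro fps_cong_mult) auto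
  also have "\<dots> = (qpoch fps_X M * inv_qpoch M) * inv_qpoch n"
    by (simp only: mult_ac)
  finally show ?thesis by simp
qed

lemma theta_term_cong_0:
  assumes "0 < b" "0 < b'" "0 < r" "n \<le> r"
  shows "fps_cong n (theta_term b b' r fps_X * f) 0"
proof -
  let ?e = "(b + b') * (r choose 2)"
  have "theta_term b b' r fps_X * f =
    fps_X ^ (?e + b * r) * ((-1) ^ r * f) + fps_X ^ (?e + b' * r) * ((-1) ^ r * f)"
    using assms by (simp add: theta_term_def power_add algebra_simps)
  also have "fps_cong n \<dots> (0 + 0)"
  proof (intro fps_cong_add fps_cong_X_power)
    have "n \<le> c * r" if "0 < c" for c :: nat
      using that assms(4) by (metis Suc_leI le_trans mult_le_mono1 nat_mult_1 One_nat_def)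
    then show "n \<le> ?e + b * r" "n \<le> ?e + b' * r"
      using assms by (meson trans_le_add2)+
  qed
  finally show ?thesis by simp
qed

text \<open>As \<open>n \<le> N - r\<close>, the symbols \<open>qpoch\<close> at
  \<open>2 * N\<close>, \<open>N + r\<close> and \<open>N - r\<close> all agree with
  \<open>qpoch\<close> at \<open>n\<close> modulo \<open>X ^ n\<close>.\<close>

lemma qbinom_cong:
  assumes "d > 0" "n + r \<le> N"
  shows "fps_cong n (qbinom (fps_X ^ d) (2 * N) (N + r) * qpoch (fps_X ^ d) n) (1 :: 'a::field fps)"
proof -
  let ?q = "fps_X ^ d :: 'a fps"
  define i where "i = inverse (qpoch ?q n)"
  have i: "qpoch ?q n * i = 1"
    using assms(1) by (simp add: i_def inverse_mult_eq_1')
  have "qbinom ?q (2 * N) (N + r) * qpoch ?q n =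
        qbinom ?q (2 * N) (N + r) * qpoch ?q n * qpoch ?q n * i"
    using i by (simp add: mult.assoc)
  also have "fps_cong n \<dots> (qbinom ?q (2 * N) (N + r) * qpoch ?q (N + r) * qpoch ?q (N - r) * i)"
    using assms by (intro fps_cong_mult fps_cong_refl fps_cong_sym[OF qpoch_cong]) auto
  also have "qbinom ?q (2 * N) (N + r) * qpoch ?q (N + r) * qpoch ?q (N - r) = qpoch ?q (2 * N)"
    using qbinom_mult_qpoch[of "N + r" "2 * N" ?q] assms by (simp add: mult_2)
  also have "fps_cong n (qpoch ?q (2 * N) * i) (qpoch ?q n * i)"
    using assms by (intro fps_cong_mult fps_cong_refl qpoch_cong) auto
  finally show ?thesis using i by simp
qed

text \<open>The factors are sorted by residue modulo 5. Residues 2 and 3 appear in the form of the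
  triple product with \<open>b = 2\<close> and \<open>b' = 3\<close>.\<close>

lemma qpoch_dissect_5:
  fixes q :: "'a::comm_ring_1"
  shows "qpoch q (5 * N) = (\<Prod>j<N. (1 - q ^ (5 * j + 1)) * (1 - q ^ (5 * j + 4))) *
    ((\<Prod>j<N. 1 - q ^ 2 * (q ^ 5) ^ j) * (\<Prod>j<N. 1 - q ^ 3 * (q ^ 5) ^ j)) * qpoch (q ^ 5) N"
proof (induction N)
  case (Suc N)
  have "qpoch q (5 * Suc N) = qpoch q (5 * N) * (1 - q ^ (5 * N + 1)) * (1 - q ^ (5 * N + 2))
     * (1 - q ^ (5 * N + 3)) * (1 - q ^ (5 * N + 4)) * (1 - q ^ (5 * N + 5))"
    by (simp add: qpoch_Suc eval_nat_numeral del: power_Suc)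
  moreover have "q ^ (5 * N + 2) = q ^ 2 * (q ^ 5) ^ N" "q ^ (5 * N + 3) = q ^ 3 * (q ^ 5) ^ N"
      "q ^ (5 * N + 5) = (q ^ 5) ^ Suc N"
    by (simp_all only: power_mult[symmetric] power_add[symmetric]) (simp_all add: add.commute)
  ultimately show ?case
    unfolding Suc.IH qpoch_Suc prod.lessThan_Suc by (simp only: mult_ac)
qed simp

theorem rogers_ramanujan_truncated:
  defines "q \<equiv> fps_X :: 'a::field fps"
  shows "fps_cong n ((\<Sum>s\<le>n. q ^ (s * s) * inv_qpoch s) *
     (\<Prod>j<2*n. (1 - q ^ (5 * j + 1)) * (1 - q ^ (5 * j + 4)))) 1"
proof -
  \<comment> \<open>With \<open>N = 2 * n\<close>, the indices \<open>N - s\<close> and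
    \<open>N - r\<close> stay at least \<open>n\<close> for all summands that survive modulo
    \<open>X ^ n\<close>.\<close>
  define N where "N = 2 * n"
  define S where "S = (\<Sum>s\<le>n. q ^ (s * s) * inv_qpoch s)"
  define \<Theta> where "\<Theta> = (\<Sum>r\<le>n. theta_term 2 3 r q)"
  define P where "P = (\<Prod>j<N. (1 - q ^ (5 * j + 1)) * (1 - q ^ (5 * j + 4)))"
  define R where "R = (\<Prod>j<N. 1 - q ^ 2 * (q ^ 5) ^ j) * (\<Prod>j<N. 1 - q ^ 3 * (q ^ 5) ^ j)"
  have inv: "qpoch q n * inv_qpoch n = 1"
    by (simp add: q_def)
  have theta0: "fps_cong n (theta_term 2 3 r q * f) 0" if "n < r" for r f
    unfolding q_def by (rule theta_term_cong_0) (use that in auto)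

  have "fps_cong n (\<Sum>s\<le>N. q ^ (s * s) * inv_qpoch (N - s) * inv_qpoch s)
      (\<Sum>s\<le>n. q ^ (s * s) * inv_qpoch n * inv_qpoch s)"
  proof (rule fps_cong_sum_truncate)
    fix s assume "n < s"
    moreover have "s \<le> s * s" by simp
    ultimately show "fps_cong n (q ^ (s * s) * inv_qpoch (N - s) * inv_qpoch s) 0"
      unfolding q_def mult.assoc by (intro fps_cong_X_power) linarith
  qed (auto intro!: fps_cong_mult inv_qpoch_cong simp: N_def)
  also have "(\<Sum>s\<le>n. q ^ (s * s) * inv_qpoch n * inv_qpoch s) = inv_qpoch n * S"
    by (simp add: S_def sum_distrib_left mult_ac)
  finally have 1: "fps_cong n (\<Sum>s\<le>N. q ^ (s * s) * inv_qpoch (N - s) * inv_qpoch s) (inv_qpoch n * S)" .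

  have "fps_cong n (\<Sum>r\<le>N. theta_term 2 3 r q * inv_qpoch (N - r) * inv_qpoch (N + r))
     (\<Sum>r\<le>n. theta_term 2 3 r q * inv_qpoch n * inv_qpoch n)"
    by (rule fps_cong_sum_truncate)
       (auto intro!: fps_cong_mult inv_qpoch_cong theta0 simp: N_def mult.assoc)
  also have "\<dots> = inv_qpoch n * (inv_qpoch n * \<Theta>)"
    by (simp add: \<Theta>_def sum_distrib_left mult_ac)
  finally have "fps_cong n (inv_qpoch n * S) (inv_qpoch n * (inv_qpoch n * \<Theta>))"
    using 1 fps_cong_sym fps_cong_trans unfolding q_def bressoud_identity by blast
  \<comment> \<open>Multiplication by \<open>qpoch q n\<close> cancels one
    \<open>inv_qpoch n\<close> on each side.\<close>
  then have "fps_cong n (qpoch q n * (inv_qpoch n * S)) (qpoch q n * (inv_qpoch n * (inv_qpoch n * \<Theta>)))"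
    by (rule fps_cong_mult[OF fps_cong_refl])
  then have S: "fps_cong n S (inv_qpoch n * \<Theta>)"
    by (simp only: mult.assoc[symmetric] inv mult_1_left)

  have R_eq: "R = (\<Sum>r\<le>N. theta_term 2 3 r q * qbinom (q ^ 5) (2 * N) (N + r))"
    using finite_jacobi_triple[of 2 3 N, where 'a = 'a] by (simp add: R_def q_def)
  have "R * qpoch (q ^ 5) n = (\<Sum>r\<le>N. theta_term 2 3 r q * (qbinom (q ^ 5) (2 * N) (N + r) * qpoch (q ^ 5) n))"
    unfolding R_eq sum_distrib_right by (simp only: mult.assoc)
  also have "fps_cong n \<dots> (\<Sum>r\<le>n. theta_term 2 3 r q * 1)"
  proof (rule fps_cong_sum_truncate)
    fix r assume "r \<le> n"
    then show "fps_cong n (theta_term 2 3 r q * (qbinom (q ^ 5) (2 * N) (N + r) * qpoch (q ^ 5) n))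
        (theta_term 2 3 r q * 1)"
      unfolding q_def by (intro fps_cong_mult fps_cong_refl qbinom_cong) (auto simp: N_def)
  qed (auto simp: N_def theta0)
  finally have R: "fps_cong n (R * qpoch (q ^ 5) n) \<Theta>"
    by (simp add: \<Theta>_def)

  \<comment> \<open>Dissecting \<open>qpoch q (5 * N)\<close> and inserting the theta series for
    residues 0, 2, 3 leaves only the residues 1 and 4 in \<open>P\<close>.\<close>
  have "fps_cong n (qpoch q n) (qpoch q (5 * N))"
    using fps_cong_sym[OF qpoch_cong[of 1 n "5 * N", where 'a = 'a]] by (simp add: q_def N_def)
  also have "qpoch q (5 * N) = P * R * qpoch (q ^ 5) N"
    unfolding P_def R_def by (rule qpoch_dissect_5)
  also have "fps_cong n \<dots> (P * R * qpoch (q ^ 5) n)"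
    unfolding q_def by (intro fps_cong_mult fps_cong_refl qpoch_cong) (auto simp: N_def)
  also have "P * R * qpoch (q ^ 5) n = P * (R * qpoch (q ^ 5) n)"
    by (simp add: mult.assoc)
  also have "fps_cong n \<dots> (P * \<Theta>)"
    by (intro fps_cong_mult fps_cong_refl R)
  finally have P: "fps_cong n (qpoch q n) (P * \<Theta>)" .

  have "fps_cong n (S * P) (inv_qpoch n * \<Theta> * P)"
    by (intro fps_cong_mult fps_cong_refl S)
  also have "\<dots> = inv_qpoch n * (P * \<Theta>)" by (simp add: mult_ac)
  also have "fps_cong n \<dots> (inv_qpoch n * qpoch q n)"
    by (intro fps_cong_mult fps_cong_refl fps_cong_sym[OF P])
  also have "\<dots> = 1" using inv by (simp add: mult.commute)
  finally show ?thesis by (simp add: S_def P_def N_def)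
qed

section \<open>Counting by multiplicities\<close>

text \<open>A partition is encoded by its multiplicities. The value 0 outside \<open>A\<close> makes
  the encoding unique.\<close>

definition mult_funs :: "nat set \<Rightarrow> (nat \<Rightarrow> nat \<Rightarrow> bool) \<Rightarrow> nat \<Rightarrow> (nat \<Rightarrow> nat) set" where
  "mult_funs A P n = {c. (\<forall>k. k \<notin> A \<longrightarrow> c k = 0) \<and> (\<forall>k\<in>A. P k (c k)) \<and> (\<Sum>k\<in>A. k * c k) = n}"

text \<open>For \<open>k > 0\<close> this is the sum of \<open>X ^ (k * c)\<close> over all
  \<open>c\<close> satisfying \<open>Q\<close>, given by coefficients to avoid an infinite
  sum.\<close>

definition part_fps :: "nat \<Rightarrow> (nat \<Rightarrow> bool) \<Rightarrow> 'a::field fps" where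
  "part_fps k Q = Abs_fps (\<lambda>n. of_bool (k dvd n \<and> Q (n div k)))"

lemma mult_funs_empty: "mult_funs {} P n = (if n = 0 then {\<lambda>_. 0} else {})"
  by (auto simp: mult_funs_def)

text \<open>Here \<open>j\<close> is the total contributed by the part \<open>a\<close>; it is the
  summation index of the Cauchy product in \<open>card_mult_funs\<close>.\<close>

lemma bij_betw_mult_funs_insert:
  assumes "finite A" "a \<notin> A" "a > 0"
  shows "bij_betw (\<lambda>(j, c). c(a := j div a))
    (SIGMA j:{j\<in>{0..n}. a dvd j \<and> P a (j div a)}. mult_funs A P (n - j)) (mult_funs (insert a A) P n)"
proof (rule bij_betw_byWitness[where f' = "\<lambda>c. (a * c a, c(a := 0))"])
  have upd: "(\<Sum>k\<in>A. k * (c(a := x)) k) = (\<Sum>k\<in>A. k * c k)" for c x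
    using assms(2) by (intro sum.cong) auto
  show "\<forall>x\<in>(SIGMA j:{j\<in>{0..n}. a dvd j \<and> P a (j div a)}. mult_funs A P (n - j)).
     (\<lambda>c. (a * c a, c(a := 0))) ((\<lambda>(j, c). c(a := j div a)) x) = x"
    using assms(2,3) by (auto simp: mult_funs_def fun_eq_iff)
  show "\<forall>c\<in>mult_funs (insert a A) P n. (\<lambda>(j, c). c(a := j div a)) (a * c a, c(a := 0)) = c"
    using assms(3) by auto
  show "(\<lambda>(j, c). c(a := j div a)) ` (SIGMA j:{j\<in>{0..n}. a dvd j \<and> P a (j div a)}. mult_funs A P (n - j))
      \<subseteq> mult_funs (insert a A) P n"
  proof safe
    fix j c assume j: "j \<in> {0..n}" "a dvd j" "P a (j div a)" and c: "c \<in> mult_funs A P (n - j)"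
    have "(\<Sum>k\<in>insert a A. k * (c(a := j div a)) k) = n"
      unfolding sum.insert[OF assms(1,2)] upd using j c by (simp add: mult_funs_def)
    then show "c(a := j div a) \<in> mult_funs (insert a A) P n"
      unfolding mult_funs_def mem_Collect_eq
    proof (intro conjI)
      show "\<forall>k. k \<notin> insert a A \<longrightarrow> (c(a := j div a)) k = 0"
           "\<forall>k\<in>insert a A. P k ((c(a := j div a)) k)"
        using j c assms(2) by (auto simp: mult_funs_def)
    qed
  qed
  show "(\<lambda>c. (a * c a, c(a := 0))) ` mult_funs (insert a A) P n
      \<subseteq> (SIGMA j:{j\<in>{0..n}. a dvd j \<and> P a (j div a)}. mult_funs A P (n - j))"
  proof safe
    fix c assume c: "c \<in> mult_funs (insert a A) P n"
    then have s: "a * c a + (\<Sum>k\<in>A. k * c k) = n"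
      using assms by (simp add: mult_funs_def)
    then show "a * c a \<in> {0..n}" by simp
    show "a dvd a * c a" by simp
    show "P a (a * c a div a)" using c assms(3) by (simp add: mult_funs_def)
    show "c(a := 0) \<in> mult_funs A P (n - a * c a)"
      unfolding mult_funs_def using c s assms(2) upd by (auto simp: mult_funs_def)
  qed
qed

lemma card_mult_funs:
  assumes "finite A" "0 \<notin> A"
  shows "finite (mult_funs A P n) \<and>
    of_nat (card (mult_funs A P n)) = ((\<Prod>k\<in>A. part_fps k (P k)) :: 'a::field fps) $ n"
  using assms
proof (induction A arbitrary: n rule: finite_induct)
  case empty
  then show ?case by (simp add: mult_funs_empty)
next
  case (insert a A)
  define J where "J = {j\<in>{0..n}. a dvd j \<and> P a (j div a)}"
  have IH: "finite (mult_funs A P i)"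
    "(\<Prod>k\<in>A. part_fps k (P k)) $ i = (of_nat (card (mult_funs A P i)) :: 'a)" for i
    using insert by auto
  have bij: "bij_betw (\<lambda>(j, c). c(a := j div a)) (SIGMA j:J. mult_funs A P (n - j)) (mult_funs (insert a A) P n)"
    unfolding J_def using insert by (intro bij_betw_mult_funs_insert) auto
  have fin: "finite J" "finite (SIGMA j:J. mult_funs A P (n - j))"
    using IH(1) by (auto simp: J_def)
  have "((\<Prod>k\<in>insert a A. part_fps k (P k)) :: 'a fps) $ n =
      (\<Sum>i=0..n. of_bool (a dvd i \<and> P a (i div a)) * of_nat (card (mult_funs A P (n - i))))"
    using insert by (simp add: fps_mult_nth part_fps_def IH(2))
  also have "\<dots> = (\<Sum>i\<in>J. of_nat (card (mult_funs A P (n - i))))"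
    unfolding J_def by (rule sum.mono_neutral_cong_right) auto
  also have "\<dots> = of_nat (card (SIGMA j:J. mult_funs A P (n - j)))"
    using fin IH(1) by (simp add: card_SigmaI)
  also have "\<dots> = of_nat (card (mult_funs (insert a A) P n))"
    using bij_betw_same_card[OF bij] by simp
  finally show ?case
    using bij_betw_finite[OF bij] fin by simp
qed

text \<open>A truncated geometric series in \<open>X ^ k\<close>, which telescopes.\<close>

lemma part_fps_less_mult:
  assumes "k > 0" "m > 0"
  shows "part_fps k (\<lambda>c. c < m) * (1 - fps_X ^ k) = (1 - fps_X ^ (k * m) :: 'a::field fps)"
proof (rule fps_ext)
  fix n
  have n: "k dvd n \<longleftrightarrow> k dvd (n - k)" "n div k = Suc ((n - k) div k)" if "k \<le> n"
    using that assms by (simp_all add: dvd_minus_self le_div_geq)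
  have "n = k * m \<longleftrightarrow> k dvd n \<and> Suc ((n - k) div k) = m" if "k \<le> n"
    using assms n[OF that] by (metis dvd_mult_div_cancel dvd_triv_left nonzero_mult_div_cancel_left gr_implies_not0)
  then show "(part_fps k (\<lambda>c. c < m) * (1 - fps_X ^ k)) $ n = (1 - fps_X ^ (k * m) :: 'a fps) $ n"
    using assms n
    by (cases "n < k")
       (auto simp: part_fps_def algebra_simps fps_X_power_mult_nth fps_X_power_nth of_bool_def
          dest: dvd_imp_le)
qed

lemma part_fps_mult:
  assumes "k > 0"
  shows "part_fps k (\<lambda>_. True) * (1 - fps_X ^ k) = (1 :: 'a::field fps)"
proof (rule fps_ext)
  fix n
  have "k dvd n \<longleftrightarrow> k dvd (n - k)" if "k \<le> n"
    using that assms by (simp add: dvd_minus_self)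
  then show "(part_fps k (\<lambda>_. True) * (1 - fps_X ^ k)) $ n = (1 :: 'a fps) $ n"
    using assms
    by (cases "n < k")
       (auto simp: part_fps_def algebra_simps fps_X_power_mult_nth of_bool_def dest: dvd_imp_le)
qed

text \<open>A decreasing list is determined by its multiset, and conversely any multiset with the
  given multiplicities can be sorted.\<close>

lemma bij_betw_count_list:
  assumes "finite A" "0 \<notin> A"
  shows "bij_betw count_list {\<mu> \<in> partitions N. set \<mu> \<subseteq> A} (mult_funs A (\<lambda>_ _. True) N)"
  unfolding bij_betw_def
proof
  have sum: "sum_list \<mu> = (\<Sum>k\<in>A. k * count_list \<mu> k)" if "set \<mu> \<subseteq> A" for \<mu>
  proof -
    have "sum_list \<mu> = (\<Sum>k\<in>set \<mu>. k * count_list \<mu> k)"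
      using sum_list_map_eq_sum_count[of id \<mu>] by (simp add: mult.commute)
    also have "\<dots> = (\<Sum>k\<in>A. k * count_list \<mu> k)"
      using that assms(1) by (intro sum.mono_neutral_left) (auto simp: count_list_0_iff)
    finally show ?thesis .
  qed
  show "inj_on count_list {\<mu> \<in> partitions N. set \<mu> \<subseteq> A}"
  proof (rule inj_onI)
    fix \<mu> \<nu> assume *: "\<mu> \<in> {\<mu> \<in> partitions N. set \<mu> \<subseteq> A}" "\<nu> \<in> {\<mu> \<in> partitions N. set \<mu> \<subseteq> A}"
      and eq: "count_list \<mu> = count_list \<nu>"
    have "mset (rev \<mu>) = mset (rev \<nu>)"
      by (rule multiset_eqI) (use eq in \<open>simp add: count_mset\<close>)
    moreover have "sorted (rev \<mu>)" "sorted (rev \<nu>)"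
      using * by (auto simp: partitions_def sorted_wrt_rev)
    ultimately have "rev \<mu> = rev \<nu>"
      by (metis properties_for_sort)
    then show "\<mu> = \<nu>" by simp
  qed
  show "count_list ` {\<mu> \<in> partitions N. set \<mu> \<subseteq> A} = mult_funs A (\<lambda>_ _. True) N"
  proof safe
    fix \<mu> assume "\<mu> \<in> partitions N" "set \<mu> \<subseteq> A"
    then show "count_list \<mu> \<in> mult_funs A (\<lambda>_ _. True) N"
      by (auto simp: mult_funs_def sum partitions_def count_list_0_iff)
  next
    fix c assume c: "c \<in> mult_funs A (\<lambda>_ _. True) N"
    define M where "M = (\<Sum>k\<in>A. replicate_mset (c k) k)"
    define \<mu> where "\<mu> = rev (sorted_list_of_multiset M)"
    have cnt: "count_list \<mu> = c"
    proof
      fix k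
      have "count_list \<mu> k = count M k"
        by (metis \<mu>_def count_mset mset_rev mset_sorted_list_of_multiset)
      also have "\<dots> = (\<Sum>j\<in>A. if j = k then c k else 0)"
        unfolding M_def count_sum by (intro sum.cong) auto
      also have "\<dots> = c k"
        using c assms(1) by (auto simp: mult_funs_def)
      finally show "count_list \<mu> k = c k" .
    qed
    have set: "set \<mu> \<subseteq> A"
    proof
      fix k assume "k \<in> set \<mu>"
      then have "c k \<noteq> 0" using cnt by (metis count_list_0_iff)
      then show "k \<in> A" using c by (auto simp: mult_funs_def)
    qed
    have "sorted_wrt (\<ge>) \<mu>"
      by (simp add: \<mu>_def sorted_wrt_rev)
    moreover have "\<forall>x\<in>set \<mu>. 0 < x"
      using set assms(2) by (metis gr0I subsetD)
    moreover have "sum_list \<mu> = N"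
      using c by (simp add: sum[OF set] cnt mult_funs_def)
    ultimately have "\<mu> \<in> {\<mu> \<in> partitions N. set \<mu> \<subseteq> A}"
      using set by (simp add: partitions_def)
    then show "c \<in> count_list ` {\<mu> \<in> partitions N. set \<mu> \<subseteq> A}"
      using cnt by blast
  qed
qed

section \<open>Staircases, rows and columns\<close>

definition staircase_add :: "nat \<Rightarrow> (nat \<Rightarrow> nat) \<Rightarrow> nat list" where
  "staircase_add m r = map (\<lambda>i. 2 * (m - i) - 1 + r i) [0..<m]"

lemma length_staircase_add [simp]: "length (staircase_add m r) = m"
  by (simp add: staircase_add_def)

lemma nth_staircase_add: "i < m \<Longrightarrow> staircase_add m r ! i = 2 * (m - i) - 1 + r i"
  by (simp add: staircase_add_def)

lemma sum_odd: "(\<Sum>i<m. 2 * (m - i) - 1) = m * (m :: nat)"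
proof -
  have "(\<Sum>i<m. 2 * (m - i) - 1) = (\<Sum>i<m. 2 * (m - Suc i) + 1)"
    by (rule sum.cong) auto
  also have "\<dots> = (\<Sum>i<m. 2 * i + 1)"
    by (rule sum.nat_diff_reindex)
  also have "\<dots> = m * m"
    by (induction m) auto
  finally show ?thesis .
qed

lemma sum_list_staircase_add: "sum_list (staircase_add m r) = m * m + (\<Sum>i<m. r i)"
  unfolding staircase_add_def interv_sum_list_conv_sum_set_nat set_upt lessThan_atLeast0[symmetric]
    sum.distrib sum_odd ..

text \<open>The steps of the staircase have height 2, and adding decreasing rows keeps every gap at
  least that large.\<close>

lemma staircase_add_Diff2:
  assumes "antimono r"
  shows "staircase_add m r \<in> Diff2"
proof -
  have r: "r j \<le> r i" if "i \<le> j" for i j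
    using assms that by (rule antimonoD)
  have "staircase_add m r ! j \<le> staircase_add m r ! i" if "i < j" "j < m" for i j
    using that r[of i j] by (simp only: nth_staircase_add) linarith
  moreover have "staircase_add m r ! Suc i + 2 \<le> staircase_add m r ! i" if "Suc i < m" for i
    using that r[of i "Suc i"] by (simp only: nth_staircase_add) linarith
  moreover have "\<forall>x\<in>set (staircase_add m r). 0 < x"
    by (auto simp: staircase_add_def)
  ultimately show ?thesis
    by (simp add: Diff2_def sorted_wrt_iff_nth_less)
qed

text \<open>Column \<open>j\<close> ends at the first row shorter than \<open>j\<close>, so its
  length is \<open>k\<close> exactly when \<open>r k < j \<le> r (k - 1)\<close>. The claim counts
  these \<open>j\<close>.\<close>

lemma count_list_col_staircase_add:
  assumes r: "antimono r" "\<And>i. m \<le> i \<Longrightarrow> r i = 0" and k: "0 < k" "k \<le> m"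
  shows "count_list (col (staircase_add m r)) k = r (k - 1) - r k"
proof -
  define B where "B = Suc (Max (insert 0 (r ` {..<m})))"
  define L where "L = (\<lambda>j. length (filter (\<lambda>x. j \<le> x) (map r [0..<m])))"
  have len: "L j = k \<longleftrightarrow> r k < j \<and> j \<le> r (k - 1)" if "0 < j" for j
  proof -
    define t where "t = (LEAST i. r i < j)"
    \<comment> \<open>The zero row \<open>m\<close> makes the \<open>LEAST\<close> in
      \<open>t\<close> well defined.\<close>
    have ex: "r m < j" using r(2) that by simp
    have "{i. i < m \<and> j \<le> r i} = {..<t}"
    proof (intro set_eqI iffI)
      fix i assume "i \<in> {i. i < m \<and> j \<le> r i}"
      moreover have "r i < j" if "t \<le> i"
        using LeastI[of "\<lambda>i. r i < j", OF ex] antimonoD[OF r(1) that] by (simp add: t_def)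
      ultimately show "i \<in> {..<t}" by force
    next
      fix i assume i: "i \<in> {..<t}"
      then have "j \<le> r i" using not_less_Least[of i "\<lambda>i. r i < j"] by (auto simp: t_def)
      then show "i \<in> {i. i < m \<and> j \<le> r i}"
        using r(2)[of i] that by (cases "i < m") auto
    qed
    then have "L j = t"
      by (simp add: L_def length_filter_conv_card cong: conj_cong)
    moreover have "t = k \<longleftrightarrow> r k < j \<and> j \<le> r (k - 1)"
    proof
      assume "t = k"
      then show "r k < j \<and> j \<le> r (k - 1)"
        using LeastI[of "\<lambda>i. r i < j", OF ex] not_less_Least[of "k - 1" "\<lambda>i. r i < j"] k
        by (auto simp: t_def)
    next
      assume *: "r k < j \<and> j \<le> r (k - 1)"
      show "t = k" unfolding t_def
      proof (rule Least_equality)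
        fix y assume "r y < j"
        show "k \<le> y"
        proof (rule ccontr)
          assume "\<not> k \<le> y"
          then have "r (k - 1) \<le> r y" by (intro antimonoD[OF r(1)]) auto
          then show False using * \<open>r y < j\<close> by linarith
        qed
      qed (use * in simp)
    qed
    ultimately show ?thesis by simp
  qed
  \<comment> \<open>No column of length \<open>k\<close> lies beyond the range of
    \<open>conjugate\<close>.\<close>
  have "r (k - 1) < B"
    unfolding B_def less_Suc_eq_le using k by (intro Max_ge) auto
  have "map (\<lambda>i. staircase_add m r ! i - (2 * (length (staircase_add m r) - i) - 1))
      [0..<length (staircase_add m r)] = map r [0..<m]"
    by (simp add: staircase_add_def)
  then have "col (staircase_add m r) = map L [1..<B]"
    by (simp only: col_def conjugate_def B_def L_def set_map set_upt lessThan_atLeast0)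
  then have "count_list (col (staircase_add m r)) k =
      length (filter (\<lambda>j. L j = k) [1..<B])"
    by (simp only: count_list_eq_length_filter filter_map length_map o_def eq_commute)
  also have "\<dots> = card {j \<in> {1..<B}. L j = k}"
    by (subst distinct_length_filter) (auto intro: arg_cong[where f = card])
  also have "{j \<in> {1..<B}. L j = k} = {r k<..r (k - 1)}"
  proof (rule set_eqI)
    fix j
    show "j \<in> {j \<in> {1..<B}. L j = k} \<longleftrightarrow> j \<in> {r k<..r (k - 1)}"
      using len[of j] \<open>r (k - 1) < B\<close> by (cases "0 < j") (auto simp: Suc_le_eq)
  qed
  finally show ?thesis by simp
qed

text \<open>Row \<open>i\<close>, counted from 0, of the diagram with \<open>c k\<close> columns of length \<open>k\<close> meets exactly the columns of length greater than \<open>i\<close>.\<close>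

definition rows_of_mults :: "nat \<Rightarrow> (nat \<Rightarrow> nat) \<Rightarrow> nat \<Rightarrow> nat" where
  "rows_of_mults m c i = (\<Sum>k\<in>{i<..m}. c k)"

lemma rows_of_mults_antimono: "antimono (rows_of_mults m c)"
  unfolding rows_of_mults_def by (intro antimonoI sum_mono2) auto

text \<open>Double counting of cells: a column of length \<open>k\<close> meets rows 0 to
  \<open>k - 1\<close>.\<close>

lemma sum_rows_of_mults: "(\<Sum>i<m. rows_of_mults m c i) = (\<Sum>k\<in>{1..m}. k * c k)"
proof -
  have "(\<Sum>i<m. rows_of_mults m c i) = (\<Sum>i\<in>{..<m}. \<Sum>k | k \<in> {1..m} \<and> i < k. c k)"
    unfolding rows_of_mults_def by (intro sum.cong) auto
  also have "\<dots> = (\<Sum>k\<in>{1..m}. \<Sum>i | i \<in> {..<m} \<and> i < k. c k)"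
    by (rule sum.swap_restrict) auto
  also have "\<dots> = (\<Sum>k\<in>{1..m}. k * c k)"
  proof (rule sum.cong)
    fix k assume "k \<in> {1..m}"
    then have "{i. i \<in> {..<m} \<and> i < k} = {..<k}" by auto
    then show "(\<Sum>i | i \<in> {..<m} \<and> i < k. c k) = k * c k" by simp
  qed simp
  finally show ?thesis .
qed

lemma Diff2_conv_staircase_add:
  assumes "\<mu> \<in> Diff2" "length \<mu> = m"
  defines "r \<equiv> (\<lambda>i. if i < m then \<mu> ! i - (2 * (m - i) - 1) else 0)"
  shows "antimono r" "\<And>i. m \<le> i \<Longrightarrow> r i = 0" "\<mu> = staircase_add m r"
proof -
  show "antimono r"
    unfolding antimono_iff_le_Suc
  proof
    fix i
    show "r (Suc i) \<le> r i"
    proof (cases "Suc i < m")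
      case True
      then have "\<mu> ! Suc i + 2 \<le> \<mu> ! i"
        using assms(1,2) by (auto simp: Diff2_def)
      then show ?thesis using True by (auto simp: r_def)
    qed (simp add: r_def)
  qed
  show "\<mu> = staircase_add m r"
  proof (rule nth_equalityI)
    fix i assume "i < length \<mu>"
    then show "\<mu> ! i = staircase_add m r ! i"
      using Diff2_staircase_le[OF assms(1), of i] assms(2) by (simp only: nth_staircase_add r_def) simp
  qed (simp add: assms(2))
qed (simp add: r_def)

text \<open>The differences telescope upwards from row \<open>m\<close>, where both sides are
  0.\<close>

lemma rows_of_mults_diff:
  assumes "antimono r" "r m = 0" "i \<le> m"
  shows "rows_of_mults m (\<lambda>k. if k \<in> {1..m} then r (k - 1) - r k else 0) i = r i"
  using assms(3)
proof (induction i rule: inc_induct)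
  case (step i)
  have "{i<..m} = insert (Suc i) {Suc i<..m}" using step by auto
  moreover have "r (Suc i) \<le> r i" using assms(1) by (simp add: antimonoD)
  ultimately show ?case using step by (simp add: rows_of_mults_def)
qed (use assms in \<open>simp add: rows_of_mults_def\<close>)

text \<open>Removing the staircase and recording column multiplicities is a bijection, with inverse
  given by rebuilding the rows. The staircase accounts for \<open>m * m\<close>.\<close>

lemma card_Diff2_length:
  "card {\<mu> \<in> partitions N. \<mu> \<in> Diff2 \<and> length \<mu> = m \<and> (\<forall>k\<in>{1..m}. P k (count_list (col \<mu>) k))} =
   card {c. (\<forall>k. k \<notin> {1..m} \<longrightarrow> c k = 0) \<and> (\<forall>k\<in>{1..m}. P k (c k)) \<and> m * m + (\<Sum>k\<in>{1..m}. k * c k) = N}"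
  (is "card ?S = card ?T")
proof -
  let ?f = "\<lambda>\<mu> k. if k \<in> {1..m} then count_list (col \<mu>) k else 0"
  let ?g = "\<lambda>c. staircase_add m (rows_of_mults m c)"
  have gf: "?g (?f \<mu>) = \<mu>" if \<mu>: "\<mu> \<in> ?S" for \<mu>
  proof -
    define r where "r = (\<lambda>i. if i < m then \<mu> ! i - (2 * (m - i) - 1) else 0)"
    have "antimono r" "\<mu> = staircase_add m r"
      using Diff2_conv_staircase_add[of \<mu> m, folded r_def] \<mu> by blast+
    moreover have "r i = 0" if "m \<le> i" for i
      using that by (simp add: r_def)
    ultimately have r: "antimono r" "\<And>i. m \<le> i \<Longrightarrow> r i = 0" "\<mu> = staircase_add m r"
      by blast+
    have "?f \<mu> = (\<lambda>k. if k \<in> {1..m} then r (k - 1) - r k else 0)"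
      by (subst r(3)) (auto simp: count_list_col_staircase_add[OF r(1,2)])
    then have "rows_of_mults m (?f \<mu>) i = r i" if "i \<le> m" for i
      using rows_of_mults_diff[OF r(1) r(2)[OF le_refl] that] by simp
    then have "?g (?f \<mu>) = staircase_add m r"
      by (simp add: staircase_add_def)
    then show ?thesis using r(3) by simp
  qed
  have fg: "?f (?g c) k = c k" if c: "c \<in> ?T" for c k
  proof (cases "k \<in> {1..m}")
    case True
    have "{k - 1<..m} = insert k {k<..m}" using True by auto
    then have "rows_of_mults m c (k - 1) = c k + rows_of_mults m c k"
      by (simp add: rows_of_mults_def)
    moreover have "count_list (col (?g c)) k = rows_of_mults m c (k - 1) - rows_of_mults m c k"
      using True by (intro count_list_col_staircase_add rows_of_mults_antimono) (auto simp: rows_of_mults_def)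
    ultimately show ?thesis using True by simp
  qed (use c in auto)
  have sum: "sum_list (?g c) = m * m + (\<Sum>k\<in>{1..m}. k * c k)" for c
    by (simp add: sum_list_staircase_add sum_rows_of_mults)
  have "bij_betw ?f ?S ?T"
  proof (rule bij_betw_byWitness[where f' = ?g])
    show "\<forall>\<mu>\<in>?S. ?g (?f \<mu>) = \<mu>" using gf by blast
    show "\<forall>c\<in>?T. ?f (?g c) = c" using fg by blast
    show "?f ` ?S \<subseteq> ?T"
    proof (rule image_subsetI)
      fix \<mu> assume \<mu>: "\<mu> \<in> ?S"
      \<comment> \<open>The size of \<open>\<mu>\<close> is read off from its reconstruction
        \<open>?g (?f \<mu>)\<close>.\<close>
      then have "m * m + (\<Sum>k\<in>{1..m}. k * ?f \<mu> k) = N"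
        using sum[of "?f \<mu>"] unfolding gf[OF \<mu>] by (simp add: partitions_def)
      then show "?f \<mu> \<in> ?T" using \<mu> by simp
    qed
    show "?g ` ?T \<subseteq> ?S"
    proof (rule image_subsetI)
      fix c assume c: "c \<in> ?T"
      have D: "?g c \<in> Diff2" by (rule staircase_add_Diff2[OF rows_of_mults_antimono])
      moreover have "?g c \<in> partitions N"
        using D c sum[of c] by (simp add: partitions_def Diff2_def)
      moreover have "count_list (col (?g c)) k = c k" if "k \<in> {1..m}" for k
        using fg[OF c, of k] that by simp
      ultimately show "?g c \<in> ?S" using c by simp
    qed
  qed
  then show ?thesis by (rule bij_betw_same_card)
qed

lemma card_Diff2_length_fps:
  "of_nat (card {\<mu> \<in> partitions N. \<mu> \<in> Diff2 \<and> length \<mu> = m \<and> (\<forall>k\<in>{1..m}. P k (count_list (col \<mu>) k))}) =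
   (fps_X ^ (m * m) * (\<Prod>k\<in>{1..m}. part_fps k (P k)) :: 'a::field fps) $ N"
proof -
  have "{c. (\<forall>k. k \<notin> {1..m} \<longrightarrow> c k = 0) \<and> (\<forall>k\<in>{1..m}. P k (c k)) \<and> m * m + (\<Sum>k\<in>{1..m}. k * c k) = N} =
     (if N < m * m then {} else mult_funs {1..m} P (N - m * m))"
    by (auto simp: mult_funs_def)
  then show ?thesis
    using card_mult_funs[of "{1..m}" P "N - m * m", where 'a = 'a]
    unfolding card_Diff2_length by (simp add: fps_X_power_mult_nth)
qed

section \<open>Removing four factors\<close>

definition fps_deg_le :: "nat \<Rightarrow> 'a::field fps \<Rightarrow> bool" where
  "fps_deg_le d f \<longleftrightarrow> (\<forall>i>d. f $ i = 0)"

lemma fps_deg_le_mult: "fps_deg_le d f \<Longrightarrow> fps_deg_le e g \<Longrightarrow> fps_deg_le (d + e) (f * g)"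
  unfolding fps_deg_le_def fps_mult_nth
  by (intro allI impI sum.neutral ballI) (metis add_le_mono le_add_diff_inverse atLeastAtMost_iff mult_eq_0_iff not_le)

lemma fps_deg_le_simps:
  "fps_deg_le k (fps_X ^ k)"
  "fps_deg_le k (1 - fps_X ^ k)"
  "fps_deg_le k (1 + fps_X ^ k)"
  "fps_deg_le (2 * k) (1 + fps_X ^ k + fps_X ^ (2 * k))"
  by (auto simp: fps_deg_le_def fps_X_power_nth)

text \<open>The exponents 1, 4, 6, 9 are the numbers below 11 that are congruent to 1 or 4 modulo
  5.\<close>

definition deleted_factors :: "'a::field fps" where
  "deleted_factors = (1 - fps_X ^ 1) * (1 - fps_X ^ 4) * (1 - fps_X ^ 6) * (1 - fps_X ^ 9)"

lemma inv_qpoch_mult_eqI: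
  assumes "f = qpoch fps_X s * g"
  shows "inv_qpoch s * f = (g :: 'a::field fps)"
proof -
  have "inv_qpoch s * f = (qpoch fps_X s * inv_qpoch s) * g"
    by (simp only: assms mult_ac)
  then show ?thesis by simp
qed

text \<open>The denominator divides the deleted factors in each case. The resulting degree bounds
  are 20, 20, 21, 23 and 26 for \<open>s\<close> from 0 to 4; the last is the source of
  \<open>N \<ge> 27\<close>.\<close>

lemma small_term_degree_le:
  assumes "s \<le> 4"
  shows "fps_deg_le 26 (fps_X ^ (s * s) * (inv_qpoch s * (deleted_factors :: 'a::field fps)))"
proof -
  let ?q = "fps_X :: 'a fps"
  have mono: "fps_deg_le d f \<Longrightarrow> d \<le> 26 \<Longrightarrow> fps_deg_le 26 f" for d and f :: "'a fps"
    by (simp add: fps_deg_le_def)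
  have q: "qpoch ?q 1 = 1 - ?q ^ 1" "qpoch ?q 2 = (1 - ?q ^ 1) * (1 - ?q ^ 2)"
    "qpoch ?q 3 = (1 - ?q ^ 1) * (1 - ?q ^ 2) * (1 - ?q ^ 3)"
    "qpoch ?q 4 = (1 - ?q ^ 1) * (1 - ?q ^ 2) * (1 - ?q ^ 3) * (1 - ?q ^ 4)"
    by (simp_all add: qpoch_def eval_nat_numeral)
  have sq: "1 - x ^ (2 * k) = (1 - x ^ k) * (1 + x ^ k)"
    and cb: "1 - x ^ (3 * k) = (1 - x ^ k) * (1 + x ^ k + x ^ (2 * k))" for x :: "'a fps" and k
    by (simp_all add: algebra_simps mult_2 power_add eval_nat_numeral)
  \<comment> \<open>The factor \<open>1 - X ^ 6\<close> absorbs \<open>1 - X ^ 3\<close> for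
    \<open>s = 3\<close>, but \<open>1 - X ^ 2\<close> for \<open>s = 4\<close>, where
    \<open>1 - X ^ 3\<close> goes into \<open>1 - X ^ 9\<close>.\<close>
  note s2 = sq[of _ 2, simplified] and s3 = sq[of _ 3, simplified]
  note c2 = cb[of _ 2, simplified] and c3 = cb[of _ 3, simplified]
  consider "s = 0" | "s = 1" | "s = 2" | "s = 3" | "s = 4" using assms by linarith
  then show ?thesis
  proof cases
    case 1
    then have "inv_qpoch s * deleted_factors = (1 - ?q ^ 1) * (1 - ?q ^ 4) * (1 - ?q ^ 6) * (1 - ?q ^ 9)"
      by (simp add: deleted_factors_def)
    then show ?thesis unfolding 1
      by (simp only:) (rule mono, (rule fps_deg_le_mult fps_deg_le_simps)+, simp)
  next
    case 2
    have "inv_qpoch s * deleted_factors = (1 - ?q ^ 4) * (1 - ?q ^ 6) * (1 - ?q ^ 9)"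
      unfolding 2 by (rule inv_qpoch_mult_eqI) (simp only: q deleted_factors_def mult_ac)
    then show ?thesis unfolding 2
      by (simp only:) (rule mono, (rule fps_deg_le_mult fps_deg_le_simps)+, simp)
  next
    case 3
    have "inv_qpoch s * deleted_factors = (1 + ?q ^ 2) * (1 - ?q ^ 6) * (1 - ?q ^ 9)"
      unfolding 3 by (rule inv_qpoch_mult_eqI) (simp only: q deleted_factors_def s2 mult_ac)
    then show ?thesis unfolding 3
      by (simp only:) (rule mono, (rule fps_deg_le_mult fps_deg_le_simps)+, simp)
  next
    case 4
    have "inv_qpoch s * deleted_factors = (1 + ?q ^ 2) * (1 + ?q ^ 3) * (1 - ?q ^ 9)"
      unfolding 4 by (rule inv_qpoch_mult_eqI) (simp only: q deleted_factors_def s2 s3 mult_ac)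
    then show ?thesis unfolding 4
      by (simp only:) (rule mono, (rule fps_deg_le_mult fps_deg_le_simps)+, simp)
  next
    case 5
    have "inv_qpoch s * deleted_factors = (1 + ?q ^ 2 + ?q ^ (2 * 2)) * (1 + ?q ^ 3 + ?q ^ (2 * 3))"
      unfolding 5 by (rule inv_qpoch_mult_eqI) (simp only: q deleted_factors_def c2 c3 mult_ac, simp)
    then show ?thesis unfolding 5
      by (simp only:) (rule mono, (rule fps_deg_le_mult fps_deg_le_simps)+, simp)
  qed
qed

text \<open>Absence of \<open>k\<close> is written as \<open>c < 1\<close>, so that
  \<open>part_fps_less_mult\<close> covers both kinds of condition.\<close>

definition col_constraint :: "nat \<Rightarrow> nat \<Rightarrow> nat \<Rightarrow> bool" where
  "col_constraint m k c \<longleftrightarrow>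
     (if m \<le> 8 then (k \<in> {2, 3} \<longrightarrow> c < 3) \<and> (k \<in> {1, 4} \<longrightarrow> c < 1) else k \<in> {1, 4, 6, 9} \<longrightarrow> c < 1)"

lemma col_constraint_small:
  assumes "5 \<le> m" "m \<le> 8"
  shows "(\<forall>k\<in>{1..m}. col_constraint m k (c k)) \<longleftrightarrow> c 2 < 3 \<and> c 3 < 3 \<and> c 1 < 1 \<and> c 4 < 1"
proof
  assume *: "\<forall>k\<in>{1..m}. col_constraint m k (c k)"
  show "c 2 < 3 \<and> c 3 < 3 \<and> c 1 < 1 \<and> c 4 < 1"
    using *[rule_format, of 1] *[rule_format, of 2] *[rule_format, of 3] *[rule_format, of 4] assms
    by (simp add: col_constraint_def)
next
  assume *: "c 2 < 3 \<and> c 3 < 3 \<and> c 1 < 1 \<and> c 4 < 1"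
  have "col_constraint m k (c k)" for k
    using * assms(2) by (auto simp: col_constraint_def)
  then show "\<forall>k\<in>{1..m}. col_constraint m k (c k)" by blast
qed

lemma col_constraint_large:
  assumes "9 \<le> m"
  shows "(\<forall>k\<in>{1..m}. col_constraint m k (c k)) \<longleftrightarrow> c 1 < 1 \<and> c 4 < 1 \<and> c 6 < 1 \<and> c 9 < 1"
proof
  assume *: "\<forall>k\<in>{1..m}. col_constraint m k (c k)"
  show "c 1 < 1 \<and> c 4 < 1 \<and> c 6 < 1 \<and> c 9 < 1"
    using *[rule_format, of 1] *[rule_format, of 4] *[rule_format, of 6] *[rule_format, of 9] assms
    by (simp add: col_constraint_def)
next
  assume *: "c 1 < 1 \<and> c 4 < 1 \<and> c 6 < 1 \<and> c 9 < 1"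
  have "col_constraint m k (c k)" for k
    using * assms by (auto simp: col_constraint_def)
  then show "\<forall>k\<in>{1..m}. col_constraint m k (c k)" by blast
qed

text \<open>After multiplication by \<open>qpoch fps_X s\<close> the product is compared factor by
  factor: unrestricted column lengths give 1, and the restricted ones give the deleted
  factors.\<close>

lemma inv_qpoch_mult_deleted_factors:
  assumes "5 \<le> s"
  shows "inv_qpoch s * deleted_factors = (\<Prod>k=1..s. part_fps k (col_constraint s k) :: 'a::field fps)"
proof (rule inv_qpoch_mult_eqI)
  let ?q = "fps_X :: 'a fps"
  define K where "K = (if s \<le> 8 then {1, 2, 3, 4} else {1, 4, 6, 9 :: nat})"
  \<comment> \<open>The exponents 6 and 9 arise as \<open>2 * 3\<close> and \<open>3 * 3\<close>
    when \<open>s \<le> 8\<close>, and directly from columns of length 6 and 9 otherwise.\<close>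
  define h where "h k = (if s \<le> 8 \<and> k \<in> {2, 3} then 1 - ?q ^ (k * 3) else 1 - ?q ^ (k * 1))" for k
  have factor: "part_fps k (col_constraint s k) * (1 - ?q ^ k) = (if k \<in> K then h k else 1)" if "k \<in> {1..s}" for k
  proof -
    have k: "k > 0" using that by simp
    consider "s \<le> 8" "k \<in> {2, 3}" | "k \<in> K" "\<not> (s \<le> 8 \<and> k \<in> {2, 3})" | "k \<notin> K" by blast
    then show ?thesis
    proof cases
      case 1
      then have "col_constraint s k = (\<lambda>c. c < 3)"
        by (auto simp: col_constraint_def)
      then show ?thesis using 1 part_fps_less_mult[OF k, of 3] by (auto simp: h_def K_def)
    next
      case 2
      then have "col_constraint s k = (\<lambda>c. c < 1)"
        by (auto simp: col_constraint_def K_def split: if_splits)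
      then show ?thesis using 2 part_fps_less_mult[OF k, of 1, where 'a = 'a] by (simp only: h_def if_True if_False zero_less_one)
    next
      case 3
      then have "col_constraint s k = (\<lambda>c. True)"
        by (auto simp: col_constraint_def K_def split: if_splits)
      then show ?thesis using 3 part_fps_mult[OF k] by simp
    qed
  qed
  have "qpoch ?q s * (\<Prod>k=1..s. part_fps k (col_constraint s k)) =
     (\<Prod>k=1..s. part_fps k (col_constraint s k) * (1 - ?q ^ k))"
    by (simp add: qpoch_def prod.distrib mult.commute)
  also have "\<dots> = (\<Prod>k=1..s. if k \<in> K then h k else 1)"
    by (intro prod.cong factor) auto
  also have "\<dots> = (\<Prod>k\<in>K. h k)"
    by (rule prod.mono_neutral_cong_right) (use assms in \<open>auto simp: K_def split: if_splits\<close>)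
  also have "\<dots> = deleted_factors"
    by (auto simp: K_def h_def deleted_factors_def mult_ac)
  finally show "deleted_factors = qpoch ?q s * (\<Prod>k=1..s. part_fps k (col_constraint s k))" ..
qed

section \<open>Comparison of the two counts\<close>

lemma prod_residues_1_4:
  fixes q :: "'a::comm_ring_1"
  shows "(\<Prod>j<M. (1 - q ^ (5 * j + 1)) * (1 - q ^ (5 * j + 4))) =
    (\<Prod>k | k < 5 * M \<and> (k mod 5 = 1 \<or> k mod 5 = 4). 1 - q ^ k)"
proof (induction M)
  case (Suc M)
  have "{k. k < 5 * Suc M \<and> (k mod 5 = 1 \<or> k mod 5 = 4)} =
     insert (5 * M + 1) (insert (5 * M + 4) {k. k < 5 * M \<and> (k mod 5 = 1 \<or> k mod 5 = 4)})"
    (is "?L = ?R")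
  proof (intro set_eqI)
    fix k
    show "k \<in> ?L \<longleftrightarrow> k \<in> ?R" by simp presburger
  qed
  then show ?case
    using Suc.IH by (simp add: mult_ac)
qed simp

lemma card_restricted_partitions:
  assumes "N \<ge> 27"
  shows "of_nat (card {\<mu> \<in> partitions N. (\<forall>x\<in>set \<mu>. x mod 5 = 1 \<or> x mod 5 = 4) \<and> Min (set \<mu>) \<ge> 11}) =
    (\<Sum>s\<le>Suc N. (fps_X ^ (s * s) * (inv_qpoch s * deleted_factors) :: 'a::field fps) $ N)"
proof -
  let ?q = "fps_X :: 'a fps"
  \<comment> \<open>Coefficient \<open>N\<close> is the last one visible modulo
    \<open>X ^ n\<close>.\<close>
  define n where "n = Suc N"
  \<comment> \<open>The bound matches the truncated product and exceeds every part of a partition of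
    \<open>N\<close>.\<close>
  define A where "A = {k. 11 \<le> k \<and> k < 5 * (2 * n) \<and> (k mod 5 = 1 \<or> k mod 5 = 4)}"
  have A: "finite A" "0 \<notin> A" by (auto simp: A_def)
  define G where "G = (\<Prod>k\<in>A. part_fps k (\<lambda>_. True) :: 'a fps)"
  define S where "S = (\<Sum>s\<le>n. ?q ^ (s * s) * inv_qpoch s)"
  define E where "E = (\<Prod>k\<in>A. 1 - ?q ^ k)"
  have "{\<mu> \<in> partitions N. (\<forall>x\<in>set \<mu>. x mod 5 = 1 \<or> x mod 5 = 4) \<and> Min (set \<mu>) \<ge> 11} =
    {\<mu> \<in> partitions N. set \<mu> \<subseteq> A}"
  proof (intro Collect_cong conj_cong refl)
    fix \<mu> assume \<mu>: "\<mu> \<in> partitions N"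
    \<comment> \<open>\<open>N > 0\<close> excludes the empty partition, for which
      \<open>Min\<close> is unspecified.\<close>
    then have "set \<mu> \<noteq> {}" using assms by (auto simp: partitions_def)
    moreover have "x < 5 * (2 * n)" if "x \<in> set \<mu>" for x
      using member_le_sum_list[OF that] \<mu> by (simp add: partitions_def n_def)
    ultimately show "(\<forall>x\<in>set \<mu>. x mod 5 = 1 \<or> x mod 5 = 4) \<and> Min (set \<mu>) \<ge> 11 \<longleftrightarrow> set \<mu> \<subseteq> A"
      by (auto simp: A_def)
  qed
  then have "of_nat (card {\<mu> \<in> partitions N. (\<forall>x\<in>set \<mu>. x mod 5 = 1 \<or> x mod 5 = 4) \<and> Min (set \<mu>) \<ge> 11})
      = G $ N"
    using bij_betw_same_card[OF bij_betw_count_list[OF A, of N]] card_mult_funs[OF A, of "\<lambda>_ _. True" N, where 'a = 'a]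
    by (simp add: G_def)
  also have "G $ N = (S * deleted_factors) $ N"
  proof -
    have EG: "E * G = 1"
      unfolding E_def G_def prod.distrib[symmetric]
    proof (rule prod.neutral, rule ballI)
      fix k assume "k \<in> A"
      then have "0 < k" by (simp add: A_def)
      then show "(1 - ?q ^ k) * part_fps k (\<lambda>_. True) = 1"
        by (subst mult.commute) (rule part_fps_mult)
    qed
    have small: "k mod 5 = 1 \<or> k mod 5 = 4 \<longleftrightarrow> k \<in> {1, 4, 6, 9}" if "k < 11" for k :: nat
      using that unfolding insert_iff empty_iff by presburger
    have "{k. k < 5 * (2 * n) \<and> (k mod 5 = 1 \<or> k mod 5 = 4)} = insert 1 (insert 4 (insert 6 (insert 9 A)))"
      (is "?L = ?R")
    proof (rule set_eqI)
      fix k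
      show "k \<in> ?L \<longleftrightarrow> k \<in> ?R"
      proof (cases "k < 11")
        case True
        then show ?thesis using small[of k] by (auto simp: A_def n_def)
      next
        case False
        then show ?thesis by (auto simp: A_def)
      qed
    qed
    then have "(\<Prod>j<2 * n. (1 - ?q ^ (5 * j + 1)) * (1 - ?q ^ (5 * j + 4))) = deleted_factors * E"
      unfolding prod_residues_1_4 using A(1) by (simp add: deleted_factors_def E_def A_def mult.assoc)
    then have RR: "fps_cong n (S * (deleted_factors * E)) 1"
      using rogers_ramanujan_truncated[of n, where 'a = 'a] by (simp only: S_def)
    \<comment> \<open>Multiplying the identity by \<open>G\<close> cancels \<open>E\<close>, leaving
      only the deleted factors beside the sum.\<close>
    have "G = 1 * G" by simp
    also have "fps_cong n \<dots> (S * (deleted_factors * E) * G)"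
      by (intro fps_cong_mult fps_cong_refl fps_cong_sym[OF RR])
    also have "\<dots> = S * deleted_factors"
      using EG by (simp add: mult.assoc)
    finally show ?thesis by (simp add: fps_cong_def n_def)
  qed
  also have "\<dots> = (\<Sum>s\<le>n. (?q ^ (s * s) * (inv_qpoch s * deleted_factors)) $ N)"
    by (simp add: S_def sum_distrib_right fps_sum_nth mult.assoc)
  finally show ?thesis by (simp add: n_def)
qed

lemma length_le_partitions: "\<mu> \<in> partitions N \<Longrightarrow> length \<mu> \<le> N"
proof -
  have "length \<mu> \<le> sum_list \<mu>" if "\<forall>x\<in>set \<mu>. 0 < x" for \<mu> :: "nat list"
    using that by (induction \<mu>) auto
  then show "\<mu> \<in> partitions N \<Longrightarrow> length \<mu> \<le> N" by (auto simp: partitions_def)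
qed

theorem theorem9:
  fixes N :: nat
  assumes "N \<ge> 27"
  shows "card {\<mu> \<in> partitions N.
            (\<forall>x\<in>set \<mu>. x mod 5 = 1 \<or> x mod 5 = 4) \<and> Min (set \<mu>) \<ge> 11} =
         card {\<mu> \<in> partitions N. \<mu> \<in> Diff2 \<and>
            ((5 \<le> length \<mu> \<and> length \<mu> \<le> 8 \<and>
                count_list (col \<mu>) 2 \<le> 2 \<and> count_list (col \<mu>) 3 \<le> 2 \<and>
                1 \<notin> set (col \<mu>) \<and> 4 \<notin> set (col \<mu>)) \<or>
             (9 \<le> length \<mu> \<and>
                1 \<notin> set (col \<mu>) \<and> 4 \<notin> set (col \<mu>) \<and>
                6 \<notin> set (col \<mu>) \<and> 9 \<notin> set (col \<mu>)))}"
    (is "card ?L = card ?R")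
proof -
  \<comment> \<open>Over \<open>rat\<close> the map \<open>of_nat\<close> is injective, so equal
    coefficients give equal cardinalities.\<close>
  define T where "T s = (fps_X ^ (s * s) * (inv_qpoch s * deleted_factors) :: rat fps)" for s
  define D where "D m = {\<mu> \<in> partitions N. \<mu> \<in> Diff2 \<and> length \<mu> = m \<and>
    (\<forall>k\<in>{1..m}. col_constraint m k (count_list (col \<mu>) k))}" for m
  have D: "of_nat (card (D m)) = T m $ N" if "5 \<le> m" for m
    unfolding D_def T_def card_Diff2_length_fps inv_qpoch_mult_deleted_factors[OF that] ..
  have small: "T m $ N = 0" if "m \<le> 4" for m
    using small_term_degree_le[OF that, where 'a = rat] assms by (simp add: fps_deg_le_def T_def)
  have "?R = (\<Union>m\<in>{5..Suc N}. D m)"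
  proof (intro set_eqI)
    fix \<mu>
    have no: "x \<notin> set ys \<longleftrightarrow> count_list ys x < 1" for x and ys :: "nat list"
      by (simp add: count_list_0_iff)
    show "\<mu> \<in> ?R \<longleftrightarrow> \<mu> \<in> (\<Union>m\<in>{5..Suc N}. D m)"
    proof (cases "\<mu> \<in> partitions N \<and> 5 \<le> length \<mu>")
      case True
      then have "length \<mu> \<in> {5..Suc N}" using length_le_partitions[of \<mu> N] by auto
      then have "\<mu> \<in> (\<Union>m\<in>{5..Suc N}. D m) \<longleftrightarrow> \<mu> \<in> D (length \<mu>)"
        by (auto simp: D_def)
      then show ?thesis
        using True col_constraint_small[of "length \<mu>" "count_list (col \<mu>)"] col_constraint_large[of "length \<mu>" "count_list (col \<mu>)"]
        by (cases "length \<mu> \<le> 8") (simp_all add: D_def no less_Suc_eq_le[of _ 2, simplified])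
    qed (auto simp: D_def)
  qed
  then have "card ?R = (\<Sum>m\<in>{5..Suc N}. card (D m))"
    by (simp only:, intro card_UN_disjoint)
       (auto simp: D_def intro: finite_subset[OF _ finite_partitions])
  then have "rat_of_nat (card ?R) = (\<Sum>m\<in>{5..Suc N}. T m $ N)"
    by (simp add: D)
  \<comment> \<open>The terms with \<open>m \<le> 4\<close> have degree at most 26 and contribute
    nothing at \<open>N\<close>.\<close>
  also have "\<dots> = (\<Sum>m\<le>Suc N. T m $ N)"
    by (rule sum.mono_neutral_left) (auto intro!: small)
  also have "\<dots> = rat_of_nat (card ?L)"
    unfolding T_def card_restricted_partitions[OF assms] ..
  finally show ?thesis by (simp only: of_nat_eq_iff)
qed

end
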